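(* Let $\mu$ be a finite measure on a measurable space $(\Omega,\Sigma)$, let $K$ be a compact Hausdorff space, and let $L_1(\mu)$ and $C(K)$ be the real Banach spaces. Let $0<\varepsilon<1$. Suppose that $T\in\mathcal{L}(L_1(\mu),C(K))$ has norm one and is Bochner representable (respectively, weakly compact). If $\|Tf\|>1-\frac{\varepsilon^2}{6}$ for some $f\in L_1(\mu)$ with $\|f\|=1$, then there exist a Bochner representable (respectively, weakly compact) operator $S\in\mathcal{L}(L_1(\mu),C(K))$ with $\|S\|=1$ and $g\in L_1(\mu)$ with $\|g\|=1$ such that $\|Sg\|=1$, $\|S-T\|<\varepsilon$ and $\|f-g\|<\varepsilon$.
   Context: $\mathcal{L}(X,Y)$ is the space of bounded linear operators from $X$ to $Y$ with the operator norm. A bounded linear operator $T$ from $L_1(\mu)$ into a Banach space $X$ is Bochner representable if there is a bounded strongly measurable function $g:\Omega\to X$ such that $Tf=\int_\Omega f(\omega)g(\omega)\,d\mu(\omega)$ (Bochner integral) for all $f\in L_1(\mu)$. *)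

theory Defs
  imports "HOL-Analysis.Analysis"
begin

text \<open>
  Elements of \<open>L\<^sub>1(\<mu>)\<close> are handled through their representatives, the integrable functions
  \<open>f\<close>, with the seminorm \<open>\<integral>\<bar>f\<bar> d\<mu>\<close>. An operator on \<open>L\<^sub>1(\<mu>)\<close> is a function on representatives
  of which only the values at integrable functions matter; boundedness makes it respect
  almost everywhere equality, see \<open>L1_operator_cong_AE\<close>.
\<close>

definition L1_norm :: "'a measure \<Rightarrow> ('a \<Rightarrow> real) \<Rightarrow> real" where
  "L1_norm M f = (\<integral>x. \<bar>f x\<bar> \<partial>M)"

definition L1_operator :: "'a measure \<Rightarrow> (('a \<Rightarrow> real) \<Rightarrow> 'b::real_normed_vector) \<Rightarrow> bool" where
  "L1_operator M T \<longleftrightarrow>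
     (\<forall>f g. integrable M f \<longrightarrow> integrable M g \<longrightarrow> T (\<lambda>x. f x + g x) = T f + T g) \<and>
     (\<forall>c f. integrable M f \<longrightarrow> T (\<lambda>x. c * f x) = c *\<^sub>R T f) \<and>
     (\<exists>C. \<forall>f. integrable M f \<longrightarrow> norm (T f) \<le> C * L1_norm M f)"

definition L1_unit_ball :: "'a measure \<Rightarrow> ('a \<Rightarrow> real) set" where
  "L1_unit_ball M = {f. integrable M f \<and> L1_norm M f \<le> 1}"

definition L1_opnorm :: "'a measure \<Rightarrow> (('a \<Rightarrow> real) \<Rightarrow> 'b::real_normed_vector) \<Rightarrow> real" where
  "L1_opnorm M T = (SUP f\<in>L1_unit_ball M. norm (T f))"

lemma L1_operator_cong_AE:
  assumes T: "L1_operator M T" and f: "integrable M f" and g: "integrable M g"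
    and ae: "AE x in M. f x = g x"
  shows "T f = T g"
proof -
  from T obtain C where C: "\<And>h. integrable M h \<Longrightarrow> norm (T h) \<le> C * L1_norm M h"
    unfolding L1_operator_def by blast
  have fg: "integrable M (\<lambda>x. f x - g x)"
    using f g by simp
  have "L1_norm M (\<lambda>x. f x - g x) = (\<integral>x. 0 \<partial>M)"
    unfolding L1_norm_def using f g ae by (intro integral_cong_AE) auto
  then have "T (\<lambda>x. f x - g x) = 0"
    using C[OF fg] by simp
  moreover have "T (\<lambda>x. (f x - g x) + g x) = T (\<lambda>x. f x - g x) + T g"
    using T fg g unfolding L1_operator_def by blast
  ultimately show ?thesis
    by simp
qed

text \<open>
  The library's \<^term>\<open>has_bochner_integral\<close> is restricted to second countable codomains, whereas
  \<open>C(K)\<close> is separable only for metrizable \<open>K\<close>. Hence strong measurability and the Bochner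
  integral are defined here for arbitrary normed spaces.
\<close>

definition strongly_measurable :: "'a measure \<Rightarrow> ('a \<Rightarrow> 'b::real_normed_vector) \<Rightarrow> bool" where
  "strongly_measurable M h \<longleftrightarrow>
     (\<exists>s. (\<forall>i. simple_function M (s i)) \<and> (AE x in M. (\<lambda>i. s i x) \<longlonglongrightarrow> h x))"

definition has_strong_bochner_integral ::
    "'a measure \<Rightarrow> ('a \<Rightarrow> 'b::real_normed_vector) \<Rightarrow> 'b \<Rightarrow> bool" where
  "has_strong_bochner_integral M h y \<longleftrightarrow>
     strongly_measurable M h \<and>
     (\<exists>s. (\<forall>i. Bochner_Integration.simple_bochner_integrable M (s i)) \<and>
          (\<lambda>i. \<integral>\<^sup>+x. norm (h x - s i x) \<partial>M) \<longlonglongrightarrow> 0 \<and>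
          (\<lambda>i. Bochner_Integration.simple_bochner_integral M (s i)) \<longlonglongrightarrow> y)"

definition bochner_representable ::
    "'a measure \<Rightarrow> (('a \<Rightarrow> real) \<Rightarrow> 'b::real_normed_vector) \<Rightarrow> bool" where
  "bochner_representable M T \<longleftrightarrow>
     (\<exists>g. bounded (g ` space M) \<and> strongly_measurable M g \<and>
          (\<forall>f. integrable M f \<longrightarrow> has_strong_bochner_integral M (\<lambda>x. f x *\<^sub>R g x) (T f)))"

definition weak_topology :: "'b::real_normed_vector topology" where
  "weak_topology =
     topology_generated_by {blinfun_apply \<phi> -` U | (\<phi> :: 'b \<Rightarrow>\<^sub>L real) U. open U}"

definition weakly_compact_operator ::
    "'a measure \<Rightarrow> (('a \<Rightarrow> real) \<Rightarrow> 'b::real_normed_vector) \<Rightarrow> bool" where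
  "weakly_compact_operator M T \<longleftrightarrow>
     compactin weak_topology (weak_topology closure_of (T ` L1_unit_ball M))"

end

theory Submission
  imports Defs
begin

text \<open>
  View \<open>T\<close> as the family \<open>T\<^sup>*\<delta>\<^sub>t \<in> L\<^sub>\<infinity>(\<mu>)\<close>, \<open>t \<in> K\<close>. If \<open>T f\<close> is nearly \<open>1\<close> at \<open>t\<^sub>0\<close>, then the density
  \<open>\<phi>\<close> of \<open>T\<^sup>*\<delta>\<close> at \<open>t\<^sub>0\<close> is close to \<open>sgn f\<close> on a set \<open>B\<close> carrying almost all the mass of \<open>f\<close>. Suppose
  moreover that \<open>t \<mapsto> 1\<^sub>B T\<^sup>*\<delta>\<^sub>t\<close> has small norm oscillation on a neighbourhood \<open>U\<close> of \<open>t\<^sub>0\<close>. Then \<open>S\<close> is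
  obtained by deforming \<open>1\<^sub>B T\<^sup>*\<delta>\<^sub>t\<close> linearly into \<open>1\<^sub>B sgn f\<close>, with a bump function supported in \<open>U\<close> as
  weight, and \<open>g\<close> is the normalized restriction of \<open>f\<close> to \<open>B\<close>.

  Small oscillation has a different source in each case. If \<open>T\<close> is represented by \<open>G\<close>, an Egorov argument
  makes \<open>G\<close> uniformly close on \<open>B\<close> to a function with finitely many values in \<open>C(K)\<close>. If \<open>T\<close> is weakly
  compact, the image of the unit ball is small on some nonempty open set as soon as it is small on
  a suitable finite set of points, and \<open>t\<^sub>0\<close> is moved into that open set.
\<close>

section \<open>Strong Bochner integrals\<close>

text \<open>Any pointwise combination of two simple functions is simple, so the approximating
  sequences can be combined term by term; joint continuity of \<open>F\<close> is what carries the
  limit over.\<close>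

lemma strongly_measurable_compose2:
  assumes "strongly_measurable M p" "strongly_measurable M q"
    and "continuous_on UNIV (\<lambda>(x, y). F x y)"
  shows "strongly_measurable M (\<lambda>x. F (p x) (q x))"
proof -
  obtain s where s: "\<And>i. simple_function M (s i)" "AE x in M. (\<lambda>i. s i x) \<longlonglongrightarrow> p x"
    using assms(1) unfolding strongly_measurable_def by blast
  obtain r where r: "\<And>i. simple_function M (r i)" "AE x in M. (\<lambda>i. r i x) \<longlonglongrightarrow> q x"
    using assms(2) unfolding strongly_measurable_def by blast
  show ?thesis
    unfolding strongly_measurable_def
  proof (intro exI[of _ "\<lambda>i x. F (s i x) (r i x)"] conjI allI)
    show "simple_function M (\<lambda>x. F (s i x) (r i x))" for i
      by (rule simple_function_compose2[OF s(1) r(1)])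
    show "AE x in M. (\<lambda>i. F (s i x) (r i x)) \<longlonglongrightarrow> F (p x) (q x)"
      using s(2) r(2)
    proof eventually_elim
      case (elim x)
      have "(\<lambda>i. (s i x, r i x)) \<longlonglongrightarrow> (p x, q x)"
        using elim by (rule tendsto_Pair)
      from continuous_on_tendsto_compose[OF assms(3) this] show ?case
        by simp
    qed
  qed
qed

lemma strongly_measurable_simple_function:
  "simple_function M s \<Longrightarrow> strongly_measurable M s"
  unfolding strongly_measurable_def by (intro exI[of _ "\<lambda>i. s"]) auto

lemma strongly_measurable_borel:
  fixes q :: "'a \<Rightarrow> 'b::{real_normed_vector, second_countable_topology}"
  assumes "q \<in> borel_measurable M"
  shows "strongly_measurable M q"
proof -
  obtain F where "\<And>i. simple_function M (F i)" "\<And>x. x \<in> space M \<Longrightarrow> (\<lambda>i. F i x) \<longlonglongrightarrow> q x"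
    using borel_measurable_implies_sequence_metric[OF assms, of 0] by metis
  then show ?thesis
    unfolding strongly_measurable_def by (intro exI[of _ F]) (simp add: AE_I2)
qed

lemma strongly_measurable_compose:
  assumes "strongly_measurable M p" "continuous_on UNIV F"
  shows "strongly_measurable M (\<lambda>x. F (p x))"
  using strongly_measurable_compose2[OF assms(1) assms(1), of "\<lambda>x y. F x"]
    continuous_on_compose2[OF assms(2) continuous_on_fst[OF continuous_on_id]]
  by (auto simp: case_prod_beta)

lemma strongly_measurable_add:
  "strongly_measurable M p \<Longrightarrow> strongly_measurable M q \<Longrightarrow> strongly_measurable M (\<lambda>x. p x + q x)"
  by (rule strongly_measurable_compose2) (auto simp: case_prod_beta intro!: continuous_intros)

lemma strongly_measurable_diff:
  "strongly_measurable M p \<Longrightarrow> strongly_measurable M q \<Longrightarrow> strongly_measurable M (\<lambda>x. p x - q x)"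
  by (rule strongly_measurable_compose2) (auto simp: case_prod_beta intro!: continuous_intros)

lemma strongly_measurable_diff_simple:
  assumes "strongly_measurable M p" "Bochner_Integration.simple_bochner_integrable M s"
  shows "strongly_measurable M (\<lambda>x. p x - s x)"
  using assms(2)
  by cases (intro strongly_measurable_diff[OF assms(1) strongly_measurable_simple_function])

lemma strongly_measurable_scaleR:
  "strongly_measurable M p \<Longrightarrow> strongly_measurable M q \<Longrightarrow> strongly_measurable M (\<lambda>x. p x *\<^sub>R q x)"
  by (rule strongly_measurable_compose2) (auto simp: case_prod_beta intro!: continuous_intros)

text \<open>\<open>M\<close> need not be complete, so \<open>p\<close> itself may fail to be Borel
  measurable. The pointwise \<open>lim\<close> of the approximating simple functions is measurable
  and can differ from \<open>p\<close> only where they do not converge to \<open>p\<close>.\<close>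

lemma strongly_measurable_real_AE:
  fixes p :: "'a \<Rightarrow> real"
  assumes "strongly_measurable M p"
  obtains q where "q \<in> borel_measurable M" "AE x in M. p x = q x"
proof -
  obtain s where s: "\<And>i. simple_function M (s i)" "AE x in M. (\<lambda>i. s i x) \<longlonglongrightarrow> p x"
    using assms unfolding strongly_measurable_def by blast
  have m[measurable]: "s i \<in> borel_measurable M" for i
    by (rule borel_measurable_simple_function[OF s(1)])
  show ?thesis
  proof
    show "(\<lambda>x. lim (\<lambda>i. s i x)) \<in> borel_measurable M"
      by (rule borel_measurable_lim_metric) (rule m)
    show "AE x in M. p x = lim (\<lambda>i. s i x)"
      using s(2) by eventually_elim (simp add: limI)
  qed
qed

lemma strongly_measurable_norm_AE:
  assumes "strongly_measurable M p"
  obtains q where "q \<in> borel_measurable M" "AE x in M. norm (p x) = q x"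
  using strongly_measurable_real_AE[OF strongly_measurable_compose[OF assms, of norm]]
  by (metis continuous_on_norm_id)

text \<open>Linearity of the nonnegative integral asks for measurable integrands, whereas the norm
  of \<open>p\<close> is only almost everywhere equal to one. The detour through \<open>q\<close>
  supplies it, here and for sums below.\<close>

lemma nn_integral_norm_cmult:
  assumes "strongly_measurable M p" "K \<ge> 0"
  shows "(\<integral>\<^sup>+x. ennreal (K * norm (p x)) \<partial>M) = ennreal K * (\<integral>\<^sup>+x. ennreal (norm (p x)) \<partial>M)"
proof -
  obtain q where [measurable]: "q \<in> borel_measurable M" and q: "AE x in M. norm (p x) = q x"
    using strongly_measurable_norm_AE[OF assms(1)] .
  have "(\<integral>\<^sup>+x. ennreal (K * norm (p x)) \<partial>M) = (\<integral>\<^sup>+x. ennreal K * ennreal (q x) \<partial>M)"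
    using q assms(2) by (intro nn_integral_cong_AE) (auto simp: ennreal_mult')
  also have "\<dots> = ennreal K * (\<integral>\<^sup>+x. ennreal (q x) \<partial>M)"
    by (rule nn_integral_cmult) auto
  also have "(\<integral>\<^sup>+x. ennreal (q x) \<partial>M) = (\<integral>\<^sup>+x. ennreal (norm (p x)) \<partial>M)"
    using q by (intro nn_integral_cong_AE) auto
  finally show ?thesis .
qed

lemma nn_integral_norm_add_le:
  assumes "strongly_measurable M p" "strongly_measurable M q"
  shows "(\<integral>\<^sup>+x. norm (p x + q x) \<partial>M) \<le> (\<integral>\<^sup>+x. norm (p x) \<partial>M) + (\<integral>\<^sup>+x. norm (q x) \<partial>M)"
proof -
  obtain p' where [measurable]: "p' \<in> borel_measurable M" and p': "AE x in M. norm (p x) = p' x"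
    using strongly_measurable_norm_AE[OF assms(1)] .
  obtain q' where [measurable]: "q' \<in> borel_measurable M" and q': "AE x in M. norm (q x) = q' x"
    using strongly_measurable_norm_AE[OF assms(2)] .
  have "(\<integral>\<^sup>+x. norm (p x + q x) \<partial>M) \<le> (\<integral>\<^sup>+x. ennreal (p' x) + ennreal (q' x) \<partial>M)"
    using p' q'
    by (intro nn_integral_mono_AE, eventually_elim)
      (metis ennreal_plus ennreal_leI norm_ge_zero norm_triangle_ineq)
  also have "\<dots> = (\<integral>\<^sup>+x. ennreal (p' x) \<partial>M) + (\<integral>\<^sup>+x. ennreal (q' x) \<partial>M)"
    by (rule nn_integral_add) auto
  also have "(\<integral>\<^sup>+x. ennreal (p' x) \<partial>M) = (\<integral>\<^sup>+x. norm (p x) \<partial>M)"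
    using p' by (intro nn_integral_cong_AE) auto
  also have "(\<integral>\<^sup>+x. ennreal (q' x) \<partial>M) = (\<integral>\<^sup>+x. norm (q x) \<partial>M)"
    using q' by (intro nn_integral_cong_AE) auto
  finally show ?thesis .
qed

lemma has_strong_bochner_integral_bounded_linear:
  assumes "bounded_linear L" "has_strong_bochner_integral M p y"
  shows "has_strong_bochner_integral M (\<lambda>x. L (p x)) (L y)"
proof -
  interpret L: bounded_linear L by fact
  obtain s where p: "strongly_measurable M p"
    and s: "\<And>i. Bochner_Integration.simple_bochner_integrable M (s i)"
      "(\<lambda>i. \<integral>\<^sup>+x. norm (p x - s i x) \<partial>M) \<longlonglongrightarrow> 0"
      "(\<lambda>i. Bochner_Integration.simple_bochner_integral M (s i)) \<longlonglongrightarrow> y"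
    using assms(2) unfolding has_strong_bochner_integral_def by blast
  have ps: "strongly_measurable M (\<lambda>x. p x - s i x)" for i
    by (rule strongly_measurable_diff_simple[OF p s(1)])
  obtain K where K: "K > 0" "\<And>x. norm (L x) \<le> norm x * K"
    using L.pos_bounded by blast
  show ?thesis
    unfolding has_strong_bochner_integral_def
  proof (intro conjI exI[of _ "\<lambda>i x. L (s i x)"] allI)
    show "strongly_measurable M (\<lambda>x. L (p x))"
      by (rule strongly_measurable_compose[OF p]) (intro L.continuous_on continuous_on_id)
    show "Bochner_Integration.simple_bochner_integrable M (\<lambda>x. L (s i x))" for i
      using s(1)[of i] simple_bochner_integrable_compose2[of "\<lambda>x y. L x" M "s i" "s i"]
      by (auto simp: L.zero)
    show "(\<lambda>i. Bochner_Integration.simple_bochner_integral M (\<lambda>x. L (s i x))) \<longlonglongrightarrow> L y"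
      using L.tendsto[OF s(3)] by (simp add: simple_bochner_integral_linear[OF L.linear_axioms s(1)])
    have le: "(\<integral>\<^sup>+x. norm (L (p x) - L (s i x)) \<partial>M) \<le> ennreal K * (\<integral>\<^sup>+x. norm (p x - s i x) \<partial>M)" for i
    proof -
      have "(\<integral>\<^sup>+x. norm (L (p x) - L (s i x)) \<partial>M) \<le> (\<integral>\<^sup>+x. ennreal (K * norm (p x - s i x)) \<partial>M)"
        using K(2) by (intro nn_integral_mono ennreal_leI) (simp add: L.diff[symmetric] mult.commute)
      then show ?thesis
        using nn_integral_norm_cmult[OF ps, of K i] K(1) by simp
    qed
    have "(\<lambda>i. ennreal K * (\<integral>\<^sup>+x. norm (p x - s i x) \<partial>M)) \<longlonglongrightarrow> 0"
      using ennreal_tendsto_cmult[OF _ s(2), of "ennreal K"] by simp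
    from tendsto_sandwich[OF _ _ tendsto_const this]
    show "(\<lambda>i. \<integral>\<^sup>+x. norm (L (p x) - L (s i x)) \<partial>M) \<longlonglongrightarrow> 0"
      using le by (simp add: always_eventually)
  qed
qed

lemma has_strong_bochner_integral_add:
  assumes "has_strong_bochner_integral M p y" "has_strong_bochner_integral M q z"
  shows "has_strong_bochner_integral M (\<lambda>x. p x + q x) (y + z)"
proof -
  obtain s where p: "strongly_measurable M p"
    and s: "\<And>i. Bochner_Integration.simple_bochner_integrable M (s i)"
      "(\<lambda>i. \<integral>\<^sup>+x. norm (p x - s i x) \<partial>M) \<longlonglongrightarrow> 0"
      "(\<lambda>i. Bochner_Integration.simple_bochner_integral M (s i)) \<longlonglongrightarrow> y"
    using assms(1) unfolding has_strong_bochner_integral_def by blast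
  obtain r where q: "strongly_measurable M q"
    and r: "\<And>i. Bochner_Integration.simple_bochner_integrable M (r i)"
      "(\<lambda>i. \<integral>\<^sup>+x. norm (q x - r i x) \<partial>M) \<longlonglongrightarrow> 0"
      "(\<lambda>i. Bochner_Integration.simple_bochner_integral M (r i)) \<longlonglongrightarrow> z"
    using assms(2) unfolding has_strong_bochner_integral_def by blast
  have ps: "strongly_measurable M (\<lambda>x. p x - s i x)" and qr: "strongly_measurable M (\<lambda>x. q x - r i x)" for i
    by (rule strongly_measurable_diff_simple[OF p s(1)], rule strongly_measurable_diff_simple[OF q r(1)])
  show ?thesis
    unfolding has_strong_bochner_integral_def
  proof (intro conjI exI[of _ "\<lambda>i x. s i x + r i x"] allI)
    show "strongly_measurable M (\<lambda>x. p x + q x)"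
      by (rule strongly_measurable_add[OF p q])
    show "Bochner_Integration.simple_bochner_integrable M (\<lambda>x. s i x + r i x)" for i
      by (rule simple_bochner_integrable_compose2) (auto intro: s r)
    show "(\<lambda>i. Bochner_Integration.simple_bochner_integral M (\<lambda>x. s i x + r i x)) \<longlonglongrightarrow> y + z"
      using tendsto_add[OF s(3) r(3)] by (simp add: simple_bochner_integral_add s r)
    have le: "(\<integral>\<^sup>+x. norm ((p x + q x) - (s i x + r i x)) \<partial>M)
        \<le> (\<integral>\<^sup>+x. norm (p x - s i x) \<partial>M) + (\<integral>\<^sup>+x. norm (q x - r i x) \<partial>M)" for i
      using nn_integral_norm_add_le[OF ps qr, of i i] by (simp add: algebra_simps)
    have "(\<lambda>i. (\<integral>\<^sup>+x. norm (p x - s i x) \<partial>M) + (\<integral>\<^sup>+x. norm (q x - r i x) \<partial>M)) \<longlonglongrightarrow> 0"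
      using tendsto_add[OF s(2) r(2)] by simp
    from tendsto_sandwich[OF _ _ tendsto_const this]
    show "(\<lambda>i. \<integral>\<^sup>+x. norm ((p x + q x) - (s i x + r i x)) \<partial>M) \<longlonglongrightarrow> 0"
      using le by (simp add: always_eventually)
  qed
qed

lemma has_strong_bochner_integral_borel:
  fixes q :: "'a \<Rightarrow> 'b::{real_normed_vector, second_countable_topology}"
  assumes "has_bochner_integral M q y"
  shows "has_strong_bochner_integral M q y"
  using assms
proof cases
  case (1 s)
  then show ?thesis
    using strongly_measurable_borel[of q M] unfolding has_strong_bochner_integral_def by auto
qed

text \<open>For real integrands the strong integral is the ordinary one, after passing to a Borel
  version; the approximation errors do not see the null set involved.\<close>

lemma has_bochner_integral_strong:
  fixes p :: "'a \<Rightarrow> real"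
  assumes "has_strong_bochner_integral M p y" "q \<in> borel_measurable M" "AE x in M. p x = q x"
  shows "has_bochner_integral M q y"
proof -
  obtain s where s: "\<And>i. Bochner_Integration.simple_bochner_integrable M (s i)"
      "(\<lambda>i. \<integral>\<^sup>+x. norm (p x - s i x) \<partial>M) \<longlonglongrightarrow> 0"
      "(\<lambda>i. Bochner_Integration.simple_bochner_integral M (s i)) \<longlonglongrightarrow> y"
    using assms(1) unfolding has_strong_bochner_integral_def by blast
  have "(\<integral>\<^sup>+x. norm (p x - s i x) \<partial>M) = (\<integral>\<^sup>+x. norm (q x - s i x) \<partial>M)" for i
    using assms(3) by (intro nn_integral_cong_AE) auto
  then show ?thesis
    using s assms(2) by (auto intro: has_bochner_integral.intros[of _ _ s])
qed

text \<open>Applying \<open>L\<close> turns the vector integral into a real one, so a pointwise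
  bound on \<open>L (p x)\<close> suffices even where \<open>norm (p x)\<close> is large. With
  \<open>L\<close> a difference of two evaluations this controls oscillation over
  \<open>K\<close>.\<close>

lemma has_strong_bochner_integral_functional_bound:
  assumes "has_strong_bochner_integral M p y" "bounded_linear (L :: _ \<Rightarrow> real)"
    and "integrable M w" "AE x in M. \<bar>L (p x)\<bar> \<le> w x"
  shows "\<bar>L y\<bar> \<le> (\<integral>x. w x \<partial>M)"
proof -
  have sb: "has_strong_bochner_integral M (\<lambda>x. L (p x)) (L y)"
    by (rule has_strong_bochner_integral_bounded_linear[OF assms(2,1)])
  then have "strongly_measurable M (\<lambda>x. L (p x))"
    unfolding has_strong_bochner_integral_def by blast
  then obtain q where q: "q \<in> borel_measurable M" "AE x in M. L (p x) = q x"
    using strongly_measurable_real_AE by blast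
  have "has_bochner_integral M q (L y)"
    by (rule has_bochner_integral_strong[OF sb q])
  then have iq: "integrable M q" "L y = integral\<^sup>L M q"
    by (auto simp: has_bochner_integral_iff)
  have "\<bar>L y\<bar> \<le> (\<integral>x. \<bar>q x\<bar> \<partial>M)"
    unfolding iq(2) by (rule integral_abs_bound)
  also have "\<dots> \<le> (\<integral>x. w x \<partial>M)"
    using iq(1) assms(3,4) q(2) by (intro integral_mono_AE) auto
  finally show ?thesis .
qed

lemma has_strong_bochner_integral_scaleR_const:
  assumes "integrable M (q :: 'a \<Rightarrow> real)"
  shows "has_strong_bochner_integral M (\<lambda>x. q x *\<^sub>R y) ((\<integral>x. q x \<partial>M) *\<^sub>R y)"
  using has_strong_bochner_integral_bounded_linear[OF bounded_linear_scaleR_left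
      has_strong_bochner_integral_borel[OF has_bochner_integral_integrable[OF assms]]] .

section \<open>Weakly compact sets of continuous functions\<close>

lemma topspace_weak_topology [simp]: "topspace weak_topology = UNIV"
proof -
  have "UNIV \<in> {blinfun_apply \<phi> -` U | (\<phi> :: 'b::real_normed_vector \<Rightarrow>\<^sub>L real) U. open U}"
    by (rule CollectI, rule exI[of _ 0], rule exI[of _ UNIV]) auto
  then show ?thesis
    unfolding weak_topology_def topology_generated_by_topspace by blast
qed

lemma continuous_map_weak_topology_functional:
  assumes "bounded_linear (L :: 'b::real_normed_vector \<Rightarrow> real)"
  shows "continuous_map weak_topology euclideanreal L"
proof -
  have L: "L = blinfun_apply (Blinfun L)"
    using assms by (simp add: bounded_linear_Blinfun_apply)
  have "openin weak_topology (blinfun_apply (Blinfun L) -` U)" if "open U" for U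
    unfolding weak_topology_def using that by (intro topology_generated_by_Basis) blast
  then have "openin weak_topology (L -` U)" if "open U" for U
    using that L by metis
  then show ?thesis
    by (simp add: continuous_map vimage_def)
qed

text \<open>Universal property of the topology generated by the functionals: only preimages of
  subbasic sets have to be checked.\<close>

lemma continuous_map_into_weak_topology:
  assumes "\<And>L :: 'b::real_normed_vector \<Rightarrow> real. bounded_linear L \<Longrightarrow> continuous_map X euclideanreal (\<lambda>x. L (f x))"
  shows "continuous_map X weak_topology f"
  unfolding weak_topology_def
proof (rule continuous_on_generated_topo)
  fix W assume "W \<in> {blinfun_apply \<phi> -` U | (\<phi> :: 'b \<Rightarrow>\<^sub>L real) U. open U}"
  then obtain \<phi> :: "'b \<Rightarrow>\<^sub>L real" and U where W: "W = blinfun_apply \<phi> -` U" "open U"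
    by blast
  have "continuous_map X euclideanreal (\<lambda>x. blinfun_apply \<phi> (f x))"
    by (rule assms) (rule blinfun.bounded_linear_right)
  then have "openin X {x \<in> topspace X. blinfun_apply \<phi> (f x) \<in> U}"
    using W(2) by (simp add: continuous_map)
  then show "openin X (f -` W \<inter> topspace X)"
    unfolding W(1) by (simp add: vimage_def Int_def conj_commute)
next
  have "\<Union> {blinfun_apply \<phi> -` U | (\<phi> :: 'b \<Rightarrow>\<^sub>L real) U. open U} = UNIV"
    using topspace_weak_topology unfolding weak_topology_def topology_generated_by_topspace .
  then show "f ` topspace X \<subseteq> \<Union> {blinfun_apply \<phi> -` U | (\<phi> :: 'b \<Rightarrow>\<^sub>L real) U. open U}"
    by simp
qed

lemma bounded_linear_apply_bcontfun: "bounded_linear (\<lambda>y :: 'k::topological_space \<Rightarrow>\<^sub>C real. apply_bcontfun y t)"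
  by (rule bounded_linear_intro[of _ 1]) (simp, simp, metis norm_bounded mult_1_right)

text \<open>Evaluations at points are bounded functionals and already separate continuous
  functions.\<close>

lemma Hausdorff_weak_topology_bcontfun:
  "Hausdorff_space (weak_topology :: ('k::topological_space \<Rightarrow>\<^sub>C real) topology)"
  unfolding Hausdorff_space_def
proof (intro allI impI)
  fix y z :: "'k \<Rightarrow>\<^sub>C real"
  assume "y \<in> topspace weak_topology \<and> z \<in> topspace weak_topology \<and> y \<noteq> z"
  then obtain t where "apply_bcontfun y t \<noteq> apply_bcontfun z t"
    using bcontfun_eqI by blast
  then obtain U V where UV: "open U" "open V" "apply_bcontfun y t \<in> U" "apply_bcontfun z t \<in> V" "U \<inter> V = {}"
    using hausdorff by metis
  have op: "openin weak_topology {y :: 'k \<Rightarrow>\<^sub>C real. apply_bcontfun y t \<in> U}" if "open U" for U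
    using continuous_map_weak_topology_functional[OF bounded_linear_apply_bcontfun[of t]] that
    by (simp add: continuous_map)
  show "\<exists>U V. openin weak_topology U \<and> openin weak_topology V \<and> y \<in> U \<and> z \<in> V \<and> disjnt U V"
    using UV op[OF UV(1)] op[OF UV(2)]
    by (intro exI[of _ "{y. apply_bcontfun y t \<in> U}"] exI[of _ "{y. apply_bcontfun y t \<in> V}"])
      (auto simp: disjnt_def)
qed

text \<open>Compact sets are closed in a Hausdorff topology, so \<open>C\<close> contains the weak
  closure of \<open>A\<close>. Weak compactness of an operator thus follows from any weakly compact
  set that contains the image of the unit ball.\<close>

lemma compactin_weak_closure_of:
  fixes A C :: "('k::topological_space \<Rightarrow>\<^sub>C real) set"
  assumes "compactin weak_topology C" "A \<subseteq> C"
  shows "compactin weak_topology (weak_topology closure_of A)"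
proof -
  have "closedin weak_topology C"
    by (rule compactin_imp_closedin[OF Hausdorff_weak_topology_bcontfun assms(1)])
  then have "weak_topology closure_of A \<subseteq> C"
    by (rule closure_of_minimal[OF assms(2)])
  then show ?thesis
    using closed_compactin[OF assms(1)] by simp
qed

text \<open>
  Otherwise choose inductively \<open>h\<^sub>n \<in> A\<close> and \<open>x\<^sub>n \<in> V\<close> such that \<open>h\<^sub>n\<close> is at most \<open>1/(n+1)\<close> in modulus at the
  earlier points, while all of \<open>h\<^sub>0, \<dots>, h\<^sub>n\<close> exceed \<open>d\<close> in modulus at \<open>x\<^sub>n\<close>. A cluster point \<open>h\<close> of \<open>(h\<^sub>n)\<close> vanishes
  at every \<open>x\<^sub>n\<close>, hence at a cluster point \<open>x\<close> of \<open>(x\<^sub>n)\<close>, yet \<open>\<bar>h x\<bar> \<ge> d\<close>.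
\<close>

lemma weakly_compact_small_on_open:
  fixes A :: "('k::t2_space \<Rightarrow>\<^sub>C real) set"
  assumes K: "compact (UNIV :: 'k set)" and A: "compactin weak_topology (weak_topology closure_of A)"
    and V: "open V" "V \<noteq> {}" and d: "d > 0"
  obtains U P \<eta> where "open U" "U \<noteq> {}" "U \<subseteq> V" "finite P" "\<eta> > 0"
    "\<And>h x. h \<in> A \<Longrightarrow> (\<And>p. p \<in> P \<Longrightarrow> \<bar>apply_bcontfun h p\<bar> \<le> \<eta>) \<Longrightarrow> x \<in> U \<Longrightarrow> \<bar>apply_bcontfun h x\<bar> \<le> d"
proof (rule ccontr)
  note found = that
  assume "\<not> thesis"
  have neg: "\<exists>h\<in>A. (\<forall>p\<in>P. \<bar>apply_bcontfun h p\<bar> \<le> \<eta>) \<and> (\<exists>x\<in>U. \<bar>apply_bcontfun h x\<bar> > d)"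
    if "open U" "U \<noteq> {}" "U \<subseteq> V" "finite P" "\<eta> > 0" for U P and \<eta> :: real
    using found[of U P \<eta>] \<open>\<not> thesis\<close> that by (meson not_le)
  \<comment> \<open>\<open>Q s n r\<close> says that the pair \<open>r\<close> of a function and a
    point may be chosen at stage \<open>n\<close>. It consults \<open>s\<close> only below
    \<open>n\<close>, as the well-founded choice requires.\<close>
  define Q where "Q s n r \<longleftrightarrow> fst r \<in> A \<and> snd r \<in> V \<and> \<bar>apply_bcontfun (fst r) (snd r)\<bar> > d \<and>
      (\<forall>i<n. \<bar>apply_bcontfun (fst (s i)) (snd r)\<bar> > d) \<and>
      (\<forall>i<n. \<bar>apply_bcontfun (fst r) (snd (s i))\<bar> \<le> 1 / Suc n)"
    for s :: "nat \<Rightarrow> ('k \<Rightarrow>\<^sub>C real) \<times> 'k" and n r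
  have "\<exists>s. \<forall>n. Q s n (s n)"
  proof (rule dependent_wf_choice[of less_than])
    show "wf less_than" by simp
    show "Q f n r = Q g n r" if "\<And>z. (z, n) \<in> less_than \<Longrightarrow> f z = g z" for f g n r
      using that by (simp add: Q_def)
    show "\<exists>r. Q s n r" if prev: "\<And>i. (i, n) \<in> less_than \<Longrightarrow> Q s i (s i)" for n s
    proof -
      define U where "U = V \<inter> (\<Inter>i\<in>{..<n}. {t. \<bar>apply_bcontfun (fst (s i)) t\<bar> > d})"
      have oU: "open U"
        unfolding U_def using V(1)
        by (intro open_Int open_INT ballI open_Collect_less continuous_intros) auto
      have "U \<noteq> {}"
      proof (cases n)
        case 0
        then show ?thesis using V(2) by (simp add: U_def)
      next
        case (Suc m)
        \<comment> \<open>The point chosen last witnesses that \<open>U\<close> is nonempty: all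
          functions chosen so far, including its own companion, exceed \<open>d\<close> in modulus
          there.\<close>
        have "snd (s m) \<in> U"
          using prev[of m] Suc by (auto simp: U_def Q_def less_Suc_eq)
        then show ?thesis by blast
      qed
      from neg[OF oU this, of "(\<lambda>i. snd (s i)) ` {..<n}" "1 / Suc n"]
      obtain h x where "h \<in> A" "x \<in> U" "\<bar>apply_bcontfun h x\<bar> > d"
        "\<forall>p\<in>(\<lambda>i. snd (s i)) ` {..<n}. \<bar>apply_bcontfun h p\<bar> \<le> 1 / Suc n"
        by (auto simp: U_def)
      then have "Q s n (h, x)"
        by (auto simp: Q_def U_def)
      then show ?thesis ..
    qed
  qed
  then obtain s where s: "\<And>n. Q s n (s n)"
    by blast
  define D where "D m = closure ((\<lambda>i. snd (s i)) ` {m..})" for m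
  have "(\<Inter>m. D m) \<noteq> {}"
  proof (rule compact_space_imp_nest[of euclidean])
    show "compact_space (euclidean :: 'k topology)"
      using K by (simp add: compact_space_def)
    show "decseq D"
      unfolding D_def decseq_def by (auto intro!: closure_mono image_mono)
  qed (auto simp: D_def)
  then obtain x where x: "\<And>m. x \<in> D m"
    by blast
  \<comment> \<open>From index \<open>n\<close> on, the function \<open>fst (s n)\<close> exceeds
    \<open>d\<close> in modulus at every chosen point; the weak inequality is a closed condition and
    passes to the cluster point \<open>x\<close>.\<close>
  have hx: "\<bar>apply_bcontfun (fst (s n)) x\<bar> \<ge> d" for n
  proof -
    have "closed {t. \<bar>apply_bcontfun (fst (s n)) t\<bar> \<ge> d}"
      by (intro closed_Collect_le continuous_intros) auto
    moreover have "(\<lambda>i. snd (s i)) ` {n..} \<subseteq> {t. \<bar>apply_bcontfun (fst (s n)) t\<bar> \<ge> d}"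
    proof safe
      fix i assume "n \<le> i"
      then show "d \<le> \<bar>apply_bcontfun (fst (s n)) (snd (s i))\<bar>"
        using s[of i] \<open>n \<le> i\<close> unfolding Q_def by (metis le_neq_implies_less less_imp_le)
    qed
    ultimately have "D n \<subseteq> {t. \<bar>apply_bcontfun (fst (s n)) t\<bar> \<ge> d}"
      unfolding D_def by (rule closure_minimal[rotated])
    then show ?thesis using x by blast
  qed
  define H where "H = weak_topology closure_of A"
  \<comment> \<open>These sets are weakly closed in \<open>H\<close> and decreasing, and
    \<open>E n\<close> contains \<open>fst (s n)\<close>. Compactness of \<open>H\<close> therefore
    yields a common member, which has all the properties wanted of a cluster point.\<close>
  define E where "E n = {h \<in> H. \<bar>apply_bcontfun h x\<bar> \<ge> d \<and> (\<forall>i<n. \<bar>apply_bcontfun h (snd (s i))\<bar> \<le> 1 / Suc n)}" for n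
  have "(\<Inter>n. E n) \<noteq> {}"
  proof (rule compact_space_imp_nest[of "subtopology weak_topology H"])
    show "compact_space (subtopology weak_topology H)"
      using A unfolding H_def by (rule compact_space_subtopology)
    have cm: "continuous_map (subtopology weak_topology H) euclideanreal (\<lambda>h. apply_bcontfun h t)" for t
      by (intro continuous_map_from_subtopology continuous_map_weak_topology_functional bounded_linear_apply_bcontfun)
    have ts: "topspace (subtopology weak_topology H) = H"
      by simp
    show "closedin (subtopology weak_topology H) (E n)" for n
    proof -
      have 1: "closedin (subtopology weak_topology H) {h \<in> H. \<bar>apply_bcontfun h x\<bar> \<in> {d..}}"
        using closedin_continuous_map_preimage[OF continuous_map_real_abs[OF cm[of x]], of "{d..}"] by simp
      have 2: "closedin (subtopology weak_topology H) {h \<in> H. \<bar>apply_bcontfun h (snd (s i))\<bar> \<in> {..1 / Suc n}}" for i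
        using closedin_continuous_map_preimage[OF continuous_map_real_abs[OF cm[of "snd (s i)"]], of "{..1 / Suc n}"] by simp
      \<comment> \<open>The case \<open>n = 0\<close> stands apart because an intersection over no
        indices is the whole type, which need not be a closed subset of \<open>H\<close>.\<close>
      have "E n = {h \<in> H. \<bar>apply_bcontfun h x\<bar> \<in> {d..}} \<inter>
          (\<Inter>i\<in>{..<n}. {h \<in> H. \<bar>apply_bcontfun h (snd (s i))\<bar> \<in> {..1 / Suc n}})" if "n > 0"
        using that by (auto simp: E_def)
      moreover have "E n = {h \<in> H. \<bar>apply_bcontfun h x\<bar> \<in> {d..}}" if "n = 0"
        using that by (auto simp: E_def)
      ultimately show ?thesis
        using 1 2 by (cases "n = 0") (auto intro!: closedin_Int closedin_INT)
    qed
    have "fst (s n) \<in> E n" for n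
      using s[of n] hx[of n] closure_of_subset[of A weak_topology] by (auto simp: E_def Q_def H_def)
    then show "E n \<noteq> {}" for n
      by blast
    show "decseq E"
      unfolding decseq_Suc_iff
    proof (intro allI subsetI)
      fix n h assume "h \<in> E (Suc n)"
      moreover have "1 / real (Suc (Suc n)) \<le> 1 / real (Suc n)"
        by (simp add: field_simps)
      ultimately show "h \<in> E n"
        unfolding E_def mem_Collect_eq by (meson less_SucI order_trans)
    qed
  qed
  then obtain h where h: "\<And>n. h \<in> E n"
    by blast
  have "apply_bcontfun h (snd (s i)) = 0" for i
  proof (rule ccontr)
    assume "apply_bcontfun h (snd (s i)) \<noteq> 0"
    then obtain n where n: "n > i" "1 / Suc n < \<bar>apply_bcontfun h (snd (s i))\<bar>"
      using eventually_conj[OF eventually_gt_at_top[of i]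
          order_tendstoD(2)[OF LIMSEQ_inverse_real_of_nat, of "\<bar>apply_bcontfun h (snd (s i))\<bar>"]]
      by (auto simp: eventually_sequentially inverse_eq_divide)
    then show False
      using h[of n] by (force simp: E_def)
  qed
  moreover have "closed {t. apply_bcontfun h t = 0}"
    by (intro closed_Collect_eq continuous_intros) auto
  ultimately have "D 0 \<subseteq> {t. apply_bcontfun h t = 0}"
    unfolding D_def by (intro closure_minimal) auto
  then have "apply_bcontfun h x = 0"
    using x[of 0] by blast
  then show False
    using h[of 0] d by (simp add: E_def)
qed

text \<open>
  On the finite set \<open>P\<close> the bounded family \<open>A\<close> is totally bounded, so up to a small error only
  finitely many functions of \<open>A\<close> matter near \<open>t\<^sub>0\<close>.
\<close>

lemma weakly_compact_small_oscillation:
  fixes A :: "('k::t2_space \<Rightarrow>\<^sub>C real) set"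
  assumes K: "compact (UNIV :: 'k set)" and A: "compactin weak_topology (weak_topology closure_of A)"
    and bd: "\<And>h. h \<in> A \<Longrightarrow> norm h \<le> 1"
    and half: "\<And>h k. h \<in> A \<Longrightarrow> k \<in> A \<Longrightarrow> (1/2) *\<^sub>R (h - k) \<in> A"
    and V: "open V" "V \<noteq> {}" and d: "d > 0"
  obtains U t\<^sub>0 where "open U" "t\<^sub>0 \<in> U" "U \<subseteq> V"
    "\<And>h t. h \<in> A \<Longrightarrow> t \<in> U \<Longrightarrow> \<bar>apply_bcontfun h t - apply_bcontfun h t\<^sub>0\<bar> \<le> d"
proof -
  \<comment> \<open>The factor 1/2 compensates for passing to halved differences. Three errors of
    \<open>d / 5\<close> each enter the final triangle inequality.\<close>
  have "d / 5 / 2 > 0" using d by simp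
  from weakly_compact_small_on_open[OF K A V this]
  obtain U P \<eta> where U: "open U" "U \<noteq> {}" "U \<subseteq> V" and P: "finite P" and \<eta>: "\<eta> > 0"
    and small: "\<And>h x. h \<in> A \<Longrightarrow> (\<And>p. p \<in> P \<Longrightarrow> \<bar>apply_bcontfun h p\<bar> \<le> \<eta>) \<Longrightarrow> x \<in> U \<Longrightarrow> \<bar>apply_bcontfun h x\<bar> \<le> d / 5 / 2"
    by metis
  from U(2) obtain t\<^sub>0 where t0: "t\<^sub>0 \<in> U" by blast
  \<comment> \<open>\<open>\<kappa> h\<close> records in which cell of a grid of mesh
    \<open>2 * \<eta>\<close> each value of \<open>h\<close> on \<open>P\<close> lies. Functions
    with equal codes differ by less than \<open>2 * \<eta>\<close> on \<open>P\<close>, so half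
    their difference is at most \<open>\<eta>\<close> there. The uniform bound on \<open>A\<close>
    leaves finitely many codes.\<close>
  define \<kappa> where "\<kappa> h = (\<lambda>p\<in>P. \<lfloor>apply_bcontfun h p / (2 * \<eta>)\<rfloor>)" for h :: "'k \<Rightarrow>\<^sub>C real"
  define N where "N = \<lceil>1 / (2 * \<eta>)\<rceil>"
  have "\<kappa> ` A \<subseteq> (\<Pi>\<^sub>E p\<in>P. {-N..N})"
  proof (rule image_subsetI, rule PiE_I)
    fix h p assume h: "h \<in> A" and p: "p \<in> P"
    have "\<bar>apply_bcontfun h p\<bar> \<le> 1"
      using bd[OF h] norm_bounded[of h p] by simp
    then have "\<bar>apply_bcontfun h p / (2 * \<eta>)\<bar> \<le> 1 / (2 * \<eta>)"
      using \<eta> by (simp add: divide_right_mono)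
    also have "1 / (2 * \<eta>) \<le> N"
      unfolding N_def by simp
    finally have "\<bar>apply_bcontfun h p / (2 * \<eta>)\<bar> \<le> N" .
    then have "-N \<le> \<lfloor>apply_bcontfun h p / (2 * \<eta>)\<rfloor>" "\<lfloor>apply_bcontfun h p / (2 * \<eta>)\<rfloor> \<le> N"
      by linarith+
    then show "\<kappa> h p \<in> {-N..N}"
      using p by (simp add: \<kappa>_def)
  qed (auto simp: \<kappa>_def)
  then have fin: "finite (\<kappa> ` A)"
    by (rule finite_subset) (auto intro: finite_PiE P)
  \<comment> \<open>\<open>B\<close> realizes every code, so \<open>W\<close> has to control only
    finitely many functions near \<open>t\<^sub>0\<close>.\<close>
  then obtain B where B: "B \<subseteq> A" "finite B" "\<kappa> ` A = \<kappa> ` B"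
    using finite_subset_image[OF fin order_refl] by metis
  define W where "W = U \<inter> (\<Inter>k\<in>B. {t. \<bar>apply_bcontfun k t - apply_bcontfun k t\<^sub>0\<bar> < d / 5})"
  show ?thesis
  proof
    show "open W"
      unfolding W_def using U(1) B(2)
      by (intro open_Int open_INT ballI open_Collect_less continuous_intros) auto
    show "t\<^sub>0 \<in> W" using t0 d by (simp add: W_def)
    show "W \<subseteq> V" using U(3) by (auto simp: W_def)
    fix h t assume h: "h \<in> A" and t: "t \<in> W"
    from h B(3) obtain k where k: "k \<in> B" "\<kappa> h = \<kappa> k"
      by (metis imageE imageI)
    have "(1/2) *\<^sub>R (h - k) \<in> A"
      using half h k(1) B(1) by blast
    moreover have "\<bar>apply_bcontfun ((1/2) *\<^sub>R (h - k)) p\<bar> \<le> \<eta>" if "p \<in> P" for p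
    proof -
      have "\<lfloor>apply_bcontfun h p / (2 * \<eta>)\<rfloor> = \<lfloor>apply_bcontfun k p / (2 * \<eta>)\<rfloor>"
        using fun_cong[OF k(2), of p] that by (simp add: \<kappa>_def)
      then have "\<bar>apply_bcontfun h p / (2 * \<eta>) - apply_bcontfun k p / (2 * \<eta>)\<bar> < 1"
        by linarith
      then have "\<bar>(apply_bcontfun h p - apply_bcontfun k p) / (2 * \<eta>)\<bar> < 1"
        by (simp add: diff_divide_distrib)
      then show ?thesis
        using \<eta> by (simp add: field_simps)
    qed
    ultimately have hk: "\<bar>apply_bcontfun h x - apply_bcontfun k x\<bar> \<le> d / 5" if "x \<in> U" for x
      using small[of "(1/2) *\<^sub>R (h - k)" x] that by auto
    have "\<bar>apply_bcontfun k t - apply_bcontfun k t\<^sub>0\<bar> < d / 5"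
      using t k(1) by (auto simp: W_def)
    moreover have "t \<in> U" using t by (auto simp: W_def)
    ultimately show "\<bar>apply_bcontfun h t - apply_bcontfun h t\<^sub>0\<bar> \<le> d"
      using hk[of t] hk[OF t0] d by linarith
  qed
qed

section \<open>Operators on \<open>L\<^sub>1\<close> and their densities\<close>

lemma L1_operator_add:
  "L1_operator M T \<Longrightarrow> integrable M f \<Longrightarrow> integrable M g \<Longrightarrow> T (\<lambda>x. f x + g x) = T f + T g"
  unfolding L1_operator_def by blast

lemma L1_operator_scale:
  "L1_operator M T \<Longrightarrow> integrable M f \<Longrightarrow> T (\<lambda>x. c * f x) = c *\<^sub>R T f"
  unfolding L1_operator_def by blast

lemma L1_operator_diff:
  assumes "L1_operator M T" "integrable M f" "integrable M g"
  shows "T (\<lambda>x. f x - g x) = T f - T g"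
  using L1_operator_add[OF assms(1,2), of "\<lambda>x. -1 * g x"] L1_operator_scale[OF assms(1,3), of "-1"] assms(3)
  by simp

lemma L1_norm_nonneg: "0 \<le> L1_norm M f"
  unfolding L1_norm_def by simp

lemma L1_norm_scale: "L1_norm M (\<lambda>x. c * f x) = \<bar>c\<bar> * L1_norm M f"
  unfolding L1_norm_def by (simp add: abs_mult)

lemma zero_in_L1_unit_ball: "(\<lambda>x. 0) \<in> L1_unit_ball M"
  by (simp add: L1_unit_ball_def L1_norm_def)

text \<open>Transfers estimates from the unit ball to all integrable functions by homogeneity. If
  the seminorm of \<open>h\<close> vanishes, boundedness forces \<open>T h = 0\<close> and any
  \<open>k\<close> in the ball serves.\<close>

lemma L1_operator_normalize:
  assumes T: "L1_operator M T" and h: "integrable M h"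
  obtains k where "k \<in> L1_unit_ball M" "T h = L1_norm M h *\<^sub>R T k"
proof (cases "L1_norm M h = 0")
  case True
  obtain C where "\<And>h. integrable M h \<Longrightarrow> norm (T h) \<le> C * L1_norm M h"
    using T unfolding L1_operator_def by blast
  from this[OF h] True have "T h = 0" by simp
  then show ?thesis
    using that[OF zero_in_L1_unit_ball] True by simp
next
  case False
  show ?thesis
  proof (rule that)
    show "(\<lambda>x. inverse (L1_norm M h) * h x) \<in> L1_unit_ball M"
      using h False L1_norm_nonneg[of M h] unfolding L1_unit_ball_def by (auto simp: L1_norm_scale)
    show "T h = L1_norm M h *\<^sub>R T (\<lambda>x. inverse (L1_norm M h) * h x)"
      using False by (simp only: L1_operator_scale[OF T h]) simp
  qed
qed

lemma L1_opnorm_bound: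
  assumes T: "L1_operator M T" and h: "integrable M h"
  shows "norm (T h) \<le> L1_opnorm M T * L1_norm M h"
proof -
  obtain C where C: "\<And>h. integrable M h \<Longrightarrow> norm (T h) \<le> C * L1_norm M h"
    using T unfolding L1_operator_def by blast
  \<comment> \<open>A real \<open>SUP\<close> is an upper bound only for sets bounded above, so this
    is checked first. \<open>C\<close> may be negative, hence the absolute value.\<close>
  have bdd: "bdd_above ((\<lambda>f. norm (T f)) ` L1_unit_ball M)"
  proof (rule bdd_aboveI2)
    fix f assume f: "f \<in> L1_unit_ball M"
    have "norm (T f) \<le> C * L1_norm M f"
      using C f by (simp add: L1_unit_ball_def)
    also have "\<dots> \<le> \<bar>C\<bar> * 1"
      using f L1_norm_nonneg[of M f] unfolding L1_unit_ball_def
      by (intro mult_mono) auto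
    finally show "norm (T f) \<le> \<bar>C\<bar> * 1" .
  qed
  obtain k where k: "k \<in> L1_unit_ball M" "T h = L1_norm M h *\<^sub>R T k"
    using L1_operator_normalize[OF T h] .
  have "norm (T k) \<le> L1_opnorm M T"
    unfolding L1_opnorm_def by (rule cSUP_upper[OF k(1) bdd])
  then show ?thesis
    using L1_norm_nonneg[of M h] by (simp add: k(2) mult.commute mult_left_mono)
qed

lemma L1_opnorm_leI:
  assumes "\<And>h. integrable M h \<Longrightarrow> norm (T h) \<le> c * L1_norm M h" "0 \<le> c"
  shows "L1_opnorm M T \<le> c"
  unfolding L1_opnorm_def
proof (rule cSUP_least)
  show "L1_unit_ball M \<noteq> {}" using zero_in_L1_unit_ball by blast
  fix h assume "h \<in> L1_unit_ball M"
  then have h: "integrable M h" "L1_norm M h \<le> 1" by (auto simp: L1_unit_ball_def)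
  have "norm (T h) \<le> c * L1_norm M h" by (rule assms(1)[OF h(1)])
  also have "\<dots> \<le> c" using assms(2) h(2) by (rule mult_left_le[rotated])
  finally show "norm (T h) \<le> c" .
qed

lemma L1_operator_bounded_linear:
  assumes "bounded_linear L" "L1_operator M T"
  shows "L1_operator M (\<lambda>h. L (T h))"
proof -
  interpret L: bounded_linear L by fact
  obtain K where K: "K > 0" "\<And>x. norm (L x) \<le> norm x * K"
    using L.pos_bounded by blast
  have "norm (L (T h)) \<le> (L1_opnorm M T * K) * L1_norm M h" if "integrable M h" for h
  proof -
    have "norm (L (T h)) \<le> norm (T h) * K" by (rule K)
    also have "\<dots> \<le> (L1_opnorm M T * L1_norm M h) * K"
      using L1_opnorm_bound[OF assms(2) that] K(1) by (intro mult_right_mono) auto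
    finally show ?thesis by (simp add: ac_simps)
  qed
  then show ?thesis
    unfolding L1_operator_def
    by (auto simp: L1_operator_add[OF assms(2)] L1_operator_scale[OF assms(2)] L.add L.scale)
qed

text \<open>The duality of \<open>L\<^sub>1\<close> and \<open>L\<^sub>\<infinity>\<close> for
  functionals of norm at most one. Adding \<open>M\<close> to the signed set function given by
  \<open>\<Lambda>\<close> on indicators produces a positive measure between 0 and twice
  \<open>M\<close>; its Radon-Nikodym density minus 1 is \<open>\<phi>\<close>. The formula extends
  from indicators to all integrable functions because both sides are linear and continuous in the
  \<open>L\<^sub>1\<close> seminorm.\<close>

lemma L1_dual_density:
  fixes \<Lambda> :: "('a \<Rightarrow> real) \<Rightarrow> real"
  assumes "finite_measure M" and \<Lambda>: "L1_operator M \<Lambda>"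
    and bd: "\<And>h. integrable M h \<Longrightarrow> \<bar>\<Lambda> h\<bar> \<le> L1_norm M h"
  obtains \<phi> where "\<phi> \<in> borel_measurable M" "AE x in M. \<bar>\<phi> x\<bar> \<le> 1"
    "\<And>h. integrable M h \<Longrightarrow> \<Lambda> h = (\<integral>x. h x * \<phi> x \<partial>M)"
proof -
  interpret finite_measure M by fact
  define m where "m E = measure M E + \<Lambda> (indicator E)" for E
  have ind: "integrable M (indicat_real E)" if "E \<in> sets M" for E
    using that by (simp add: integrable_indicator_iff less_top[symmetric])
  have bdE: "\<bar>\<Lambda> (indicator E)\<bar> \<le> measure M E" if "E \<in> sets M" for E
    using bd[OF ind[OF that]] that by (simp add: L1_norm_def)
  have m0: "0 \<le> m E" "m E \<le> 2 * measure M E" if "E \<in> sets M" for E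
    using bdE[OF that] unfolding m_def by auto
  have pos: "positive (sets M) (\<lambda>E. ennreal (m E))"
    using m0[of "{}"] by (auto simp: positive_def)
  have "m (A \<union> B) = m A + m B" if "A \<in> sets M" "B \<in> sets M" "A \<inter> B = {}" for A B
  proof -
    have "indicat_real (A \<union> B) = (\<lambda>x. indicator A x + indicator B x)"
      using that(3) by (auto simp: indicator_def fun_eq_iff)
    then show ?thesis
      using L1_operator_add[OF \<Lambda> ind[OF that(1)] ind[OF that(2)]] finite_measure_Union[OF that]
      unfolding m_def by simp
  qed
  then have add: "additive (sets M) (\<lambda>E. ennreal (m E))"
    using m0 by (auto simp: additive_def ennreal_plus)
  \<comment> \<open>For a finite, finitely additive set function it is enough to have continuity at
    the empty set, which is inherited from the dominating \<open>2 * measure M\<close>.\<close>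
  have "countably_additive (sets M) (\<lambda>E. ennreal (m E))"
  proof (rule sets.empty_continuous_imp_countably_additive[OF pos add])
    fix A :: "nat \<Rightarrow> 'a set" assume A: "range A \<subseteq> sets M" "decseq A" "(\<Inter>i. A i) = {}"
    have "(\<lambda>i. measure M (A i)) \<longlonglongrightarrow> measure M (\<Inter>i. A i)"
      by (rule finite_Lim_measure_decseq[OF A(1,2)])
    then have lim: "(\<lambda>i. 2 * measure M (A i)) \<longlonglongrightarrow> 0"
      using A(3) tendsto_mult_right_zero by auto
    have "(\<lambda>i. m (A i)) \<longlonglongrightarrow> 0"
      by (rule tendsto_sandwich[OF _ _ tendsto_const lim]) (use m0 A(1) in auto)
    then show "(\<lambda>i. ennreal (m (A i))) \<longlonglongrightarrow> 0"
      using tendsto_ennrealI by fastforce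
  qed simp
  note ca = this
  define N where "N = measure_of (space M) (sets M) (\<lambda>E. ennreal (m E))"
  have sN: "sets N = sets M"
    unfolding N_def by simp
  have eN: "emeasure N E = m E" if "E \<in> sets M" for E
    unfolding N_def using emeasure_measure_of_sigma[OF sets.sigma_algebra_axioms pos ca that] .
  have "absolutely_continuous M N"
    unfolding absolutely_continuous_def
  proof
    fix E assume "E \<in> null_sets M"
    then have E: "E \<in> sets M" "measure M E = 0"
      by (auto simp: null_sets_def measure_def)
    then show "E \<in> null_sets N"
      using m0[OF E(1)] eN[OF E(1)] sN by (auto simp: null_sets_def)
  qed
  from Radon_Nikodym[OF this sN] obtain F where F: "F \<in> borel_measurable M" "density M F = N"
    by blast
  have intF: "(\<integral>\<^sup>+x. F x * indicator E x \<partial>M) = m E" if "E \<in> sets M" for E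
    using emeasure_density[OF F(1) that] eN[OF that] F(2) by simp
  have "(\<integral>\<^sup>+x. F x \<partial>M) = (\<integral>\<^sup>+x. F x * indicator (space M) x \<partial>M)"
    by (intro nn_integral_cong) auto
  then have "(\<integral>\<^sup>+x. F x \<partial>M) \<noteq> \<infinity>"
    using intF[of "space M"] by simp
  then have fin: "AE x in M. F x \<noteq> \<infinity>"
    by (rule nn_integral_PInf_AE[OF F(1)])
  \<comment> \<open>Subtracting 1 undoes the summand \<open>measure M E\<close> in \<open>m\<close>.
    Since \<open>F\<close> is finite almost everywhere, \<open>enn2real\<close> changes it only on a
    null set.\<close>
  define \<phi> where "\<phi> x = enn2real (F x) - 1" for x
  have [measurable]: "\<phi> \<in> borel_measurable M"
    unfolding \<phi>_def using F(1) by measurable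
  have hb: "has_bochner_integral M (\<lambda>x. indicator E x * enn2real (F x)) (m E)" if "E \<in> sets M" for E
  proof (rule has_bochner_integral_nn_integral)
    show "(\<lambda>x. indicator E x * enn2real (F x)) \<in> borel_measurable M"
      using F(1) that by measurable
    have "(\<integral>\<^sup>+x. ennreal (indicator E x * enn2real (F x)) \<partial>M) = (\<integral>\<^sup>+x. F x * indicator E x \<partial>M)"
      using fin by (intro nn_integral_cong_AE) (auto simp: indicator_def less_top)
    then show "(\<integral>\<^sup>+x. ennreal (indicator E x * enn2real (F x)) \<partial>M) = ennreal (m E)"
      using intF[OF that] by simp
  qed (use m0 that in auto)
  have hb\<phi>: "has_bochner_integral M (\<lambda>x. indicator E x * \<phi> x) (\<Lambda> (indicator E))" if "E \<in> sets M" for E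
  proof -
    have "has_bochner_integral M (indicat_real E) (measure M E)"
      using that ind[OF that] by (simp add: has_bochner_integral_iff)
    from has_bochner_integral_diff[OF hb[OF that] this] show ?thesis
      by (simp add: m_def \<phi>_def algebra_simps)
  qed
  have "AE x in M. \<phi> x \<le> 1"
  proof -
    \<comment> \<open>On \<open>E\<close> the function \<open>\<phi> - 1\<close> is positive, while
      \<open>bdE\<close> makes its integral over \<open>E\<close> nonpositive; hence
      \<open>E\<close> is null.\<close>
    define E where "E = {x \<in> space M. \<phi> x > 1}"
    have E: "E \<in> sets M" unfolding E_def by measurable
    have "has_bochner_integral M (indicat_real E) (measure M E)"
      using E ind[OF E] by (simp add: has_bochner_integral_iff)
    from has_bochner_integral_diff[OF hb\<phi>[OF E] this]
    have i: "has_bochner_integral M (\<lambda>x. indicator E x * \<phi> x - indicator E x) (\<Lambda> (indicator E) - measure M E)" .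
    have nn: "0 \<le> indicator E x * \<phi> x - indicator E x" for x
      by (auto simp: E_def indicator_def)
    have "(\<integral>x. indicator E x * \<phi> x - indicator E x \<partial>M) \<le> 0"
      using i bdE[OF E] by (simp add: has_bochner_integral_iff)
    moreover have "(\<integral>x. indicator E x * \<phi> x - indicator E x \<partial>M) \<ge> 0"
      by (intro integral_nonneg_AE AE_I2) (rule nn)
    ultimately have "(\<integral>x. indicator E x * \<phi> x - indicator E x \<partial>M) = 0" by simp
    then have "AE x in M. indicator E x * \<phi> x - indicator E x = 0"
      using i nn by (subst (asm) integral_nonneg_eq_0_iff_AE) (auto simp: has_bochner_integral_iff)
    with AE_space show ?thesis
      by eventually_elim (auto simp: E_def indicator_def split: if_splits)
  qed
  moreover have "\<phi> x \<ge> -1" for x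
    by (simp add: \<phi>_def)
  ultimately have \<phi>1: "AE x in M. \<bar>\<phi> x\<bar> \<le> 1"
    by (simp add: abs_le_iff minus_le_iff)
  have dom: "AE x in M. norm (h x * \<phi> x) \<le> \<bar>h x\<bar>" for h :: "'a \<Rightarrow> real"
    using \<phi>1 by eventually_elim (simp add: abs_mult mult_left_le)
  have int\<phi>: "integrable M (\<lambda>x. h x * \<phi> x)" if "integrable M h" for h :: "'a \<Rightarrow> real"
    by (rule Bochner_Integration.integrable_bound[OF that]) (use that dom[of h] in auto)
  have "\<Lambda> h = (\<integral>x. h x * \<phi> x \<partial>M)" if "integrable M h" for h
    using that
  proof (induction rule: integrable_induct)
    case (base A c)
    have "\<Lambda> (\<lambda>x. c * indicat_real A x) = c * \<Lambda> (indicator A)"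
      using L1_operator_scale[OF \<Lambda> ind[OF base(1)]] by simp
    also have "\<dots> = c * (\<integral>x. indicator A x * \<phi> x \<partial>M)"
      using hb\<phi>[OF base(1)] by (simp add: has_bochner_integral_iff)
    also have "\<dots> = (\<integral>x. (indicator A x *\<^sub>R c) * \<phi> x \<partial>M)"
      unfolding integral_mult_right_zero[symmetric]
      by (intro Bochner_Integration.integral_cong) auto
    finally show ?case
      by (simp add: mult.commute)
  next
    case (add f g)
    then show ?case
      using int\<phi>[OF add(1)] int\<phi>[OF add(2)] by (simp add: L1_operator_add[OF \<Lambda>] distrib_right)
  next
    case (lim f s)
    have "(\<lambda>i. \<Lambda> (s i) - \<Lambda> f) \<longlonglongrightarrow> 0"
    proof (rule Lim_null_comparison)
      have "norm (\<Lambda> (s i) - \<Lambda> f) \<le> (\<integral>x. \<bar>s i x - f x\<bar> \<partial>M)" for i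
        using bd[OF Bochner_Integration.integrable_diff[OF lim(1)[of i] lim(4)]]
        unfolding L1_norm_def L1_operator_diff[OF \<Lambda> lim(1)[of i] lim(4)] by simp
      then show "\<forall>\<^sub>F i in sequentially. norm (\<Lambda> (s i) - \<Lambda> f) \<le> (\<integral>x. \<bar>s i x - f x\<bar> \<partial>M)"
        by simp
      have "(\<lambda>i. \<integral>x. \<bar>s i x - f x\<bar> \<partial>M) \<longlonglongrightarrow> (\<integral>x. 0 \<partial>M)"
      \<comment> \<open>The induction rule provides
        \<open>\<bar>s i x\<bar> \<le> 2 * \<bar>f x\<bar>\<close>, whence the factor 3 for the
        difference.\<close>
      proof (rule integral_dominated_convergence[where w = "\<lambda>x. 3 * \<bar>f x\<bar>"])
        show "AE x in M. (\<lambda>i. \<bar>s i x - f x\<bar>) \<longlonglongrightarrow> 0"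
          using AE_space
        proof eventually_elim
          case (elim x)
          then show ?case
            using lim(2)[OF elim] tendsto_rabs_zero LIM_zero by blast
        qed
        show "AE x in M. norm \<bar>s i x - f x\<bar> \<le> 3 * \<bar>f x\<bar>" for i
          using AE_space
        proof eventually_elim
          case (elim x)
          then show ?case
            using lim(3)[OF elim, of i] by simp
        qed
      qed (use lim(1,4) in auto)
      then show "(\<lambda>i. \<integral>x. \<bar>s i x - f x\<bar> \<partial>M) \<longlonglongrightarrow> 0" by simp
    qed
    then have 1: "(\<lambda>i. \<Lambda> (s i)) \<longlonglongrightarrow> \<Lambda> f"
      by (rule LIM_zero_cancel)
    have 2: "(\<lambda>i. \<integral>x. s i x * \<phi> x \<partial>M) \<longlonglongrightarrow> (\<integral>x. f x * \<phi> x \<partial>M)"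
    proof (rule integral_dominated_convergence[where w = "\<lambda>x. 2 * \<bar>f x\<bar>"])
      show "AE x in M. (\<lambda>i. s i x * \<phi> x) \<longlonglongrightarrow> f x * \<phi> x"
        using AE_space by eventually_elim (intro tendsto_mult_right lim(2))
      show "AE x in M. norm (s i x * \<phi> x) \<le> 2 * \<bar>f x\<bar>" for i
        using AE_space dom[of "s i"]
      proof eventually_elim
        case (elim x)
        then show ?case
          using lim(3)[OF elim(1), of i] by simp
      qed
    qed (use lim(1,4) in auto)
    show ?case
      using LIMSEQ_unique[OF 1] 2 lim(5) by simp
  qed
  then show ?thesis
    using that \<phi>1 \<open>\<phi> \<in> borel_measurable M\<close> by blast
qed

text \<open>A compact Hausdorff space is normal, so Urysohn's lemma separates the point from the
  complement of \<open>U\<close>; values in the unit interval make the function bounded.\<close>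

lemma bcontfun_bump:
  fixes t\<^sub>0 :: "'k::t2_space"
  assumes K: "compact (UNIV :: 'k set)" and U: "open U" "t\<^sub>0 \<in> U"
  obtains u :: "'k \<Rightarrow>\<^sub>C real" where "apply_bcontfun u t\<^sub>0 = 1" "\<And>t. 0 \<le> apply_bcontfun u t"
    "\<And>t. apply_bcontfun u t \<le> 1" "\<And>t. t \<notin> U \<Longrightarrow> apply_bcontfun u t = 0"
proof -
  have "normal_space (euclidean :: 'k topology)"
    proof (rule compact_Hausdorff_or_regular_imp_normal_space)
    show "compact_space (euclidean :: 'k topology)"
      using K by (simp add: compact_space_def)
    have "Hausdorff_space (euclidean :: 'k topology)"
      unfolding Hausdorff_space_def disjnt_def using hausdorff by fastforce
    then show "Hausdorff_space (euclidean :: 'k topology) \<or> regular_space (euclidean :: 'k topology)" ..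
  qed
  moreover have "closedin euclidean (- U)" "closedin euclidean {t\<^sub>0}" "disjnt (- U) {t\<^sub>0}"
    using U by (auto simp: disjnt_def)
  ultimately obtain v :: "'k \<Rightarrow> real" where
    v: "continuous_map euclidean (top_of_set {0..1}) v" "v ` (- U) \<subseteq> {0}" "v ` {t\<^sub>0} \<subseteq> {1}"
    using Urysohn_lemma[of euclidean "- U" "{t\<^sub>0}" 0 1] by (metis zero_le_one)
  have v1: "continuous_on UNIV v" "\<And>t. v t \<in> {0..1}"
    using v(1) by (auto simp: continuous_map_in_subtopology Pi_iff)
  then have "v \<in> bcontfun"
    by (intro bcontfun_normI[of _ 1]) auto
  then obtain u where "v = apply_bcontfun u"
    using bcontfunE by blast
  with v v1 show ?thesis
    by (intro that[of u]) auto
qed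

section \<open>The deformed operator\<close>

definition bcontfun_mult :: "('k::topological_space \<Rightarrow>\<^sub>C real) \<Rightarrow> ('k \<Rightarrow>\<^sub>C real) \<Rightarrow> 'k \<Rightarrow>\<^sub>C real" where
  "bcontfun_mult u y = Bcontfun (\<lambda>t. apply_bcontfun u t * apply_bcontfun y t)"

lemma apply_bcontfun_mult [simp]:
  "apply_bcontfun (bcontfun_mult u y) t = apply_bcontfun u t * apply_bcontfun y t"
proof -
  have "norm (apply_bcontfun u t * apply_bcontfun y t) \<le> norm u * norm y" for t
    using norm_bounded[of u t] norm_bounded[of y t] by (auto simp: abs_mult intro!: mult_mono)
  then have "(\<lambda>t. apply_bcontfun u t * apply_bcontfun y t) \<in> bcontfun"
    by (intro bcontfun_normI) (auto intro!: continuous_intros)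
  then show ?thesis
    by (simp add: bcontfun_mult_def Bcontfun_inverse)
qed

lemma bounded_linear_bcontfun_mult: "bounded_linear (bcontfun_mult u)"
proof (rule bounded_linear_intro)
  show "norm (bcontfun_mult u y) \<le> norm y * norm u" for y
    using norm_bounded[of u] norm_bounded[of y]
    by (intro norm_bound) (auto simp: abs_mult mult.commute intro!: mult_mono)
qed (auto intro!: bcontfun_eqI simp: algebra_simps)

text \<open>
  On \<open>B\<close> this replaces \<open>T\<^sup>*\<delta>\<^sub>t\<close>, viewed in \<open>L\<^sub>\<infinity>\<close>, by its convex combination with \<open>sgn f\<close>, the latter of
  weight \<open>u t\<close>.
\<close>

definition bump_operator ::
    "'a measure \<Rightarrow> (('a \<Rightarrow> real) \<Rightarrow> ('k::topological_space \<Rightarrow>\<^sub>C real)) \<Rightarrow> ('k \<Rightarrow>\<^sub>C real) \<Rightarrow>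
     'a set \<Rightarrow> ('a \<Rightarrow> real) \<Rightarrow> ('a \<Rightarrow> real) \<Rightarrow> ('k \<Rightarrow>\<^sub>C real)" where
  "bump_operator M T u B f h =
     T h + (\<integral>x. (indicator B x * h x) * sgn (f x) \<partial>M) *\<^sub>R u
       - bcontfun_mult u (T (\<lambda>x. indicator B x * h x))"

section \<open>Restriction to a set and integration against a sign\<close>

lemma integrable_indicator_mult:
  "B \<in> sets M \<Longrightarrow> integrable M h \<Longrightarrow> integrable M (\<lambda>x. indicator B x * h x :: real)"
  using integrable_mult_indicator[of B M h] by simp

lemma integrable_mult_sgn:
  fixes h f :: "'a \<Rightarrow> real"
  assumes "integrable M h" "f \<in> borel_measurable M"
  shows "integrable M (\<lambda>x. h x * sgn (f x))"
proof (rule Bochner_Integration.integrable_bound[OF assms(1)])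
  show "(\<lambda>x. h x * sgn (f x)) \<in> borel_measurable M"
    using assms borel_measurable_sgn by measurable
qed (auto simp: abs_mult sgn_real_def)

lemma integral_mult_sgn_le:
  fixes h f :: "'a \<Rightarrow> real"
  assumes "integrable M h"
  shows "\<bar>\<integral>x. h x * sgn (f x) \<partial>M\<bar> \<le> L1_norm M h"
proof -
  have "\<bar>\<integral>x. h x * sgn (f x) \<partial>M\<bar> \<le> (\<integral>x. \<bar>h x * sgn (f x)\<bar> \<partial>M)"
    by (rule integral_abs_bound)
  also have "\<dots> \<le> (\<integral>x. \<bar>h x\<bar> \<partial>M)"
    by (rule integral_mono') (use assms in \<open>auto simp: abs_mult sgn_real_def\<close>)
  finally show ?thesis by (simp add: L1_norm_def)
qed

lemma L1_norm_indicator_split: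
  assumes "B \<in> sets M" "integrable M h"
  shows "L1_norm M h = L1_norm M (\<lambda>x. indicator B x * h x) + L1_norm M (\<lambda>x. indicator (space M - B) x * h x)"
proof -
  have "L1_norm M h = (\<integral>x. \<bar>indicator B x * h x\<bar> + \<bar>indicator (space M - B) x * h x\<bar> \<partial>M)"
    unfolding L1_norm_def by (intro Bochner_Integration.integral_cong) (auto simp: indicator_def)
  also have "\<dots> = (\<integral>x. \<bar>indicator B x * h x\<bar> \<partial>M) + (\<integral>x. \<bar>indicator (space M - B) x * h x\<bar> \<partial>M)"
    using assms by (intro Bochner_Integration.integral_add integrable_abs integrable_indicator_mult) auto
  finally show ?thesis by (simp add: L1_norm_def)
qed

lemma L1_norm_indicator_le:
  assumes "B \<in> sets M" "integrable M h"
  shows "L1_norm M (\<lambda>x. indicator B x * h x) \<le> L1_norm M h"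
  using L1_norm_indicator_split[OF assms] L1_norm_nonneg[of M "\<lambda>x. indicator (space M - B) x * h x"] by simp

section \<open>Norm bound, linearity and the two operator classes for the deformation\<close>

context
  fixes M :: "'a measure" and T :: "('a \<Rightarrow> real) \<Rightarrow> ('k::topological_space \<Rightarrow>\<^sub>C real)"
    and u :: "'k \<Rightarrow>\<^sub>C real" and B :: "'a set" and f :: "'a \<Rightarrow> real"
  assumes T: "L1_operator M T" and T_le: "\<And>h. integrable M h \<Longrightarrow> norm (T h) \<le> L1_norm M h"
    and B: "B \<in> sets M" and f: "integrable M f"
    and u: "\<And>t. 0 \<le> apply_bcontfun u t" "\<And>t. apply_bcontfun u t \<le> 1"
begin

text \<open>At each \<open>t\<close> the value is a convex combination, with weight
  \<open>u t\<close>, of \<open>T h\<close> at \<open>t\<close> and of \<open>c\<close> plus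
  \<open>T h'\<close> at \<open>t\<close>. The first is bounded by the norm of \<open>h\<close>; so
  is the second, because the norms of \<open>h\<close> on \<open>B\<close> and off \<open>B\<close>
  add up to that of \<open>h\<close>.\<close>

lemma bump_operator_norm_le:
  assumes h: "integrable M h"
  shows "norm (bump_operator M T u B f h) \<le> L1_norm M h"
proof (rule norm_bound)
  fix t
  define c where "c = (\<integral>x. (indicator B x * h x) * sgn (f x) \<partial>M)"
  define h' where "h' = (\<lambda>x. indicator (space M - B) x * h x)"
  have hB: "integrable M (\<lambda>x. indicator B x * h x)" and h': "integrable M h'"
    using B h unfolding h'_def by (auto intro!: integrable_indicator_mult)
  \<comment> \<open>The decomposition is guaranteed only on \<open>space M\<close>, so
    \<open>T\<close> is transferred along almost everywhere equality.\<close>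
  have "AE x in M. h x = indicator B x * h x + h' x"
    unfolding h'_def by (rule AE_I2) (auto simp: indicator_def)
  then have "T h = T (\<lambda>x. indicator B x * h x + h' x)"
    using hB h' h by (intro L1_operator_cong_AE[OF T]) auto
  then have Th: "T h = T (\<lambda>x. indicator B x * h x) + T h'"
    using L1_operator_add[OF T hB h'] by simp
  have eq: "apply_bcontfun (bump_operator M T u B f h) t =
      (1 - apply_bcontfun u t) * apply_bcontfun (T h) t + apply_bcontfun u t * (c + apply_bcontfun (T h') t)"
    unfolding bump_operator_def c_def[symmetric] Th by (simp add: algebra_simps)
  have 1: "\<bar>apply_bcontfun (T h) t\<bar> \<le> L1_norm M h"
    using norm_bounded[of "T h" t] T_le[OF h] by simp
  have "\<bar>c\<bar> \<le> L1_norm M (\<lambda>x. indicator B x * h x)"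
    unfolding c_def by (rule integral_mult_sgn_le[OF hB])
  moreover have "\<bar>apply_bcontfun (T h') t\<bar> \<le> L1_norm M h'"
    using norm_bounded[of "T h'" t] T_le[OF h'] by simp
  ultimately have 2: "\<bar>c + apply_bcontfun (T h') t\<bar> \<le> L1_norm M h"
    using L1_norm_indicator_split[OF B h] unfolding h'_def by linarith
  have "\<bar>apply_bcontfun (bump_operator M T u B f h) t\<bar> \<le>
      (1 - apply_bcontfun u t) * L1_norm M h + apply_bcontfun u t * L1_norm M h"
    unfolding eq using 1 2 u[of t]
    by (intro order_trans[OF abs_triangle_ineq] add_mono) (auto simp: abs_mult intro!: mult_left_mono)
  then show "norm (apply_bcontfun (bump_operator M T u B f h) t) \<le> L1_norm M h"
    by (simp add: algebra_simps)
qed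

lemma L1_operator_bump_operator: "L1_operator M (bump_operator M T u B f)"
  unfolding L1_operator_def
proof (intro conjI allI impI)
  interpret m: bounded_linear "bcontfun_mult u" by (rule bounded_linear_bcontfun_mult)
  have fm: "f \<in> borel_measurable M" using f by auto
  note i = integrable_indicator_mult[OF B]
  show "bump_operator M T u B f (\<lambda>x. h x + k x) = bump_operator M T u B f h + bump_operator M T u B f k"
    if h: "integrable M h" and k: "integrable M k" for h k
  proof -
    have e: "(\<lambda>x. indicator B x * (h x + k x)) = (\<lambda>x. indicator B x * h x + indicator B x * k x)"
      by (simp add: distrib_left)
    have "(\<integral>x. (indicator B x * h x + indicator B x * k x) * sgn (f x) \<partial>M) =
       (\<integral>x. (indicator B x * h x) * sgn (f x) \<partial>M) + (\<integral>x. (indicator B x * k x) * sgn (f x) \<partial>M)"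
      unfolding distrib_right
      by (intro Bochner_Integration.integral_add integrable_mult_sgn i h k fm)
    then show ?thesis
      unfolding bump_operator_def e
      by (simp add: L1_operator_add[OF T h k] L1_operator_add[OF T i[OF h] i[OF k]] m.add
          scaleR_left_distrib e distrib_left)
  qed
  show "bump_operator M T u B f (\<lambda>x. c * h x) = c *\<^sub>R bump_operator M T u B f h"
    if h: "integrable M h" for c h
  proof -
    have e: "(\<lambda>x. indicator B x * (c * h x)) = (\<lambda>x. c * (indicator B x * h x))"
      by (simp add: ac_simps)
    have "(\<integral>x. (c * (indicator B x * h x)) * sgn (f x) \<partial>M) = c * (\<integral>x. (indicator B x * h x) * sgn (f x) \<partial>M)"
      by (simp add: mult.assoc)
    then show ?thesis
      unfolding bump_operator_def
      by (simp only: e fun_cong[OF e] L1_operator_scale[OF T h] L1_operator_scale[OF T i[OF h]] m.scaleR)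
        (simp add: algebra_simps)
  qed
  show "\<exists>C. \<forall>h. integrable M h \<longrightarrow> norm (bump_operator M T u B f h) \<le> C * L1_norm M h"
    using bump_operator_norm_le by (intro exI[of _ 1]) simp
qed

text \<open>The image of the unit ball lies in the image under \<open>\<Theta>\<close> of a product
  of two copies of the weakly compact set \<open>H\<close> and a compact interval.
  \<open>\<Theta>\<close> is weakly continuous, since each functional turns it into a sum of
  functionals of the separate coordinates.\<close>

lemma weakly_compact_bump_operator:
  assumes "weakly_compact_operator M T"
  shows "weakly_compact_operator M (bump_operator M T u B f)"
proof -
  define H where "H = weak_topology closure_of (T ` L1_unit_ball M)"
  define \<Theta> where "\<Theta> = (\<lambda>((y, z), c). y - bcontfun_mult u z + c *\<^sub>R u)"
  define X where "X = prod_topology (prod_topology (weak_topology :: ('k \<Rightarrow>\<^sub>C real) topology) (weak_topology :: ('k \<Rightarrow>\<^sub>C real) topology)) euclideanreal"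
  interpret m: bounded_linear "bcontfun_mult u" by (rule bounded_linear_bcontfun_mult)
  have "compactin weak_topology H"
    using assms unfolding H_def weakly_compact_operator_def .
  then have "compactin X ((H \<times> H) \<times> {-1..1})"
    unfolding X_def by (simp add: compactin_Times)
  moreover have "continuous_map X weak_topology \<Theta>"
  proof (rule continuous_map_into_weak_topology)
    fix L :: "('k \<Rightarrow>\<^sub>C real) \<Rightarrow> real" assume L: "bounded_linear L"
    interpret L: bounded_linear L by (rule L)
    have Lm: "bounded_linear (\<lambda>z. L (bcontfun_mult u z))"
      by (rule bounded_linear_compose[OF L bounded_linear_bcontfun_mult])
    have e: "(\<lambda>p. L (\<Theta> p)) = (\<lambda>p. L (fst (fst p)) - L (bcontfun_mult u (snd (fst p))) + snd p * L u)"
      by (auto simp: \<Theta>_def fun_eq_iff L.add L.diff L.scaleR)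
    have p: "continuous_map X weak_topology (\<lambda>p. fst (fst p))"
        "continuous_map X weak_topology (\<lambda>p. snd (fst p))" "continuous_map X euclideanreal snd"
      unfolding X_def
      using continuous_map_compose[OF continuous_map_fst continuous_map_fst]
        continuous_map_compose[OF continuous_map_fst continuous_map_snd] continuous_map_snd
      by (auto simp: o_def)
    show "continuous_map X euclideanreal (\<lambda>p. L (\<Theta> p))"
      unfolding e
      using continuous_map_compose[OF p(1) continuous_map_weak_topology_functional[OF L]]
        continuous_map_compose[OF p(2) continuous_map_weak_topology_functional[OF Lm]] p(3)
      by (intro continuous_map_add continuous_map_diff continuous_map_real_mult) (auto simp: o_def)
  qed
  ultimately have "compactin weak_topology (\<Theta> ` ((H \<times> H) \<times> {-1..1}))"
    by (rule image_compactin)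
  moreover have "bump_operator M T u B f ` L1_unit_ball M \<subseteq> \<Theta> ` ((H \<times> H) \<times> {-1..1})"
  proof (rule image_subsetI)
    fix h assume "h \<in> L1_unit_ball M"
    then have h: "integrable M h" "L1_norm M h \<le> 1" "T h \<in> T ` L1_unit_ball M"
      by (auto simp: L1_unit_ball_def)
    have sub: "T ` L1_unit_ball M \<subseteq> H"
      unfolding H_def by (rule closure_of_subset) simp
    have hB: "integrable M (\<lambda>x. indicator B x * h x)" "L1_norm M (\<lambda>x. indicator B x * h x) \<le> 1"
      using integrable_indicator_mult[OF B h(1)] L1_norm_indicator_le[OF B h(1)] h(2) by auto
    then have 1: "T (\<lambda>x. indicator B x * h x) \<in> H"
      using sub by (auto simp: L1_unit_ball_def)
    have 2: "\<bar>\<integral>x. (indicator B x * h x) * sgn (f x) \<partial>M\<bar> \<le> 1"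
      using integral_mult_sgn_le[OF hB(1)] hB(2) by (rule order_trans)
    show "bump_operator M T u B f h \<in> \<Theta> ` ((H \<times> H) \<times> {-1..1})"
      using 1 2 h(3) sub
      by (intro image_eqI[of _ _ "((T h, T (\<lambda>x. indicator B x * h x)), \<integral>x. (indicator B x * h x) * sgn (f x) \<partial>M)"])
        (auto simp: \<Theta>_def bump_operator_def abs_le_iff)
  qed
  ultimately show ?thesis
    unfolding weakly_compact_operator_def by (rule compactin_weak_closure_of)
qed

text \<open>The three terms of the deformed operator are represented by \<open>G\<close>, by the
  sign of \<open>f\<close> on \<open>B\<close> times the constant vector \<open>u\<close>, and by
  minus \<open>u\<close> times \<open>G\<close> on \<open>B\<close>; \<open>G'\<close> is their
  sum.\<close>

lemma bochner_representable_bump_operator: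
  assumes "bochner_representable M T"
  shows "bochner_representable M (bump_operator M T u B f)"
proof -
  interpret m: bounded_linear "bcontfun_mult u" by (rule bounded_linear_bcontfun_mult)
  obtain G where G: "bounded (G ` space M)" "strongly_measurable M G"
    "\<And>h. integrable M h \<Longrightarrow> has_strong_bochner_integral M (\<lambda>x. h x *\<^sub>R G x) (T h)"
    using assms unfolding bochner_representable_def by blast
  define w where "w x = indicator B x * sgn (f x)" for x
  have [measurable]: "f \<in> borel_measurable M" "B \<in> sets M" using f B by auto
  have w: "w \<in> borel_measurable M" "\<bar>w x\<bar> \<le> 1" for x
    unfolding w_def using borel_measurable_sgn by (auto simp: indicator_def sgn_real_def)
  define G' where "G' x = G x + (w x *\<^sub>R u + - (indicat_real B x *\<^sub>R bcontfun_mult u (G x)))" for x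
  show ?thesis
    unfolding bochner_representable_def
  proof (intro exI[of _ G'] conjI allI impI)
    obtain C where C: "\<And>x. x \<in> space M \<Longrightarrow> norm (G x) \<le> C"
      using G(1) unfolding bounded_iff by auto
    obtain K where K: "K > 0" "\<And>x. norm (bcontfun_mult u x) \<le> norm x * K"
      using m.pos_bounded by blast
    have "norm (G' x) \<le> C + (norm u + C * K)" if x: "x \<in> space M" for x
    proof -
      have "norm (w x *\<^sub>R u) \<le> norm u"
        using w(2)[of x] by (simp add: mult_left_le_one_le)
      moreover have "norm (- (indicat_real B x *\<^sub>R bcontfun_mult u (G x))) \<le> C * K"
      proof -
        have "norm (- (indicat_real B x *\<^sub>R bcontfun_mult u (G x))) \<le> norm (bcontfun_mult u (G x))"
          by (auto simp: indicator_def)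
        also have "\<dots> \<le> norm (G x) * K" by (rule K)
        also have "\<dots> \<le> C * K" using C[OF x] K(1) by (intro mult_right_mono) auto
        finally show ?thesis .
      qed
      ultimately show ?thesis
        unfolding G'_def using C[OF x] by (intro order_trans[OF norm_triangle_ineq] add_mono) auto
    qed
    then show "bounded (G' ` space M)"
      unfolding bounded_iff by blast
    show "strongly_measurable M G'"
      unfolding G'_def diff_conv_add_uminus[symmetric]
    proof (intro strongly_measurable_add strongly_measurable_diff strongly_measurable_scaleR G(2))
      show "strongly_measurable M w" by (rule strongly_measurable_borel[OF w(1)])
      show "strongly_measurable M (indicat_real B)" by (rule strongly_measurable_borel) simp
      show "strongly_measurable M (\<lambda>x. u)" by (rule strongly_measurable_simple_function) simp
      show "strongly_measurable M (\<lambda>x. bcontfun_mult u (G x))"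
        by (rule strongly_measurable_compose[OF G(2)]) (intro m.continuous_on continuous_on_id)
    qed
    fix h :: "'a \<Rightarrow> real" assume h: "integrable M h"
    have hB: "integrable M (\<lambda>x. indicator B x * h x)"
      by (rule integrable_indicator_mult[OF B h])
    have "has_strong_bochner_integral M (\<lambda>x. ((indicator B x * h x) * sgn (f x)) *\<^sub>R u)
        ((\<integral>x. (indicator B x * h x) * sgn (f x) \<partial>M) *\<^sub>R u)"
      by (intro has_strong_bochner_integral_scaleR_const integrable_mult_sgn hB) simp
    moreover have "has_strong_bochner_integral M (\<lambda>x. - bcontfun_mult u ((indicator B x * h x) *\<^sub>R G x))
        (- bcontfun_mult u (T (\<lambda>x. indicator B x * h x)))"
      by (rule has_strong_bochner_integral_bounded_linear[OF bounded_linear_minus[OF bounded_linear_bcontfun_mult] G(3)[OF hB]])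
    ultimately have "has_strong_bochner_integral M
        (\<lambda>x. h x *\<^sub>R G x + (((indicator B x * h x) * sgn (f x)) *\<^sub>R u + - bcontfun_mult u ((indicator B x * h x) *\<^sub>R G x)))
        (T h + ((\<integral>x. (indicator B x * h x) * sgn (f x) \<partial>M) *\<^sub>R u + - bcontfun_mult u (T (\<lambda>x. indicator B x * h x))))"
      by (intro has_strong_bochner_integral_add G(3) h)
    moreover have "(\<lambda>x. h x *\<^sub>R G x + (((indicator B x * h x) * sgn (f x)) *\<^sub>R u + - bcontfun_mult u ((indicator B x * h x) *\<^sub>R G x)))
        = (\<lambda>x. h x *\<^sub>R G' x)"
      by (auto simp: G'_def w_def m.scaleR algebra_simps fun_eq_iff)
    ultimately show "has_strong_bochner_integral M (\<lambda>x. h x *\<^sub>R G' x) (bump_operator M T u B f h)"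
      by (simp add: bump_operator_def add_diff_eq)
  qed
qed

end

section \<open>Norm attaining approximation\<close>

text \<open>At \<open>t\<close> the difference of the two operators is \<open>u t\<close> times the
  gap between the pairing with \<open>sgn f\<close> on \<open>B\<close> and \<open>T hB\<close>. It
  vanishes off \<open>U\<close>; on \<open>U\<close>, replacing \<open>sgn f\<close> by
  \<open>\<phi>\<close> costs at most \<open>\<epsilon> / 2\<close> and moving from
  \<open>t\<^sub>0\<close> to \<open>t\<close> at most \<open>\<epsilon> / 4\<close>, in units of
  the norm of \<open>h\<close>.\<close>

lemma bump_operator_attains_norm:
  fixes T :: "('a \<Rightarrow> real) \<Rightarrow> ('k::t2_space \<Rightarrow>\<^sub>C real)"
  assumes K: "compact (UNIV :: 'k set)" and \<epsilon>: "0 < \<epsilon>" "\<epsilon> < 1"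
    and T: "L1_operator M T" and T_le: "\<And>h. integrable M h \<Longrightarrow> norm (T h) \<le> L1_norm M h"
    and f: "integrable M f" "L1_norm M f = 1"
    and U: "open U" "t\<^sub>0 \<in> U" and B: "B \<in> sets M"
    and \<phi>: "\<phi> \<in> borel_measurable M" "AE x in M. \<bar>\<phi> x\<bar> \<le> 1"
      "\<And>h. integrable M h \<Longrightarrow> apply_bcontfun (T h) t\<^sub>0 = (\<integral>x. h x * \<phi> x \<partial>M)"
    and B\<phi>: "\<And>x. x \<in> B \<Longrightarrow> sgn (f x) * \<phi> x > 1 - \<epsilon> / 2"
    and mass: "L1_norm M (\<lambda>x. indicator B x * f x) > 1 - \<epsilon> / 2"
    and osc: "\<And>h t. integrable M h \<Longrightarrow> t \<in> U \<Longrightarrow>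
      \<bar>apply_bcontfun (T (\<lambda>x. indicator B x * h x)) t - apply_bcontfun (T (\<lambda>x. indicator B x * h x)) t\<^sub>0\<bar>
        \<le> \<epsilon> / 4 * L1_norm M h"
  obtains u g where "\<And>t. 0 \<le> apply_bcontfun u t" "\<And>t. apply_bcontfun u t \<le> 1"
    "L1_opnorm M (bump_operator M T u B f) = 1"
    "integrable M g" "L1_norm M g = 1" "norm (bump_operator M T u B f g) = 1"
    "L1_opnorm M (\<lambda>h. bump_operator M T u B f h - T h) < \<epsilon>" "L1_norm M (\<lambda>x. f x - g x) < \<epsilon>"
proof -
  obtain u :: "'k \<Rightarrow>\<^sub>C real" where u: "apply_bcontfun u t\<^sub>0 = 1" "\<And>t. 0 \<le> apply_bcontfun u t"
    "\<And>t. apply_bcontfun u t \<le> 1" "\<And>t. t \<notin> U \<Longrightarrow> apply_bcontfun u t = 0"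
    using bcontfun_bump[OF K U] by blast
  define S where "S = bump_operator M T u B f"
  define \<beta> where "\<beta> = L1_norm M (\<lambda>x. indicator B x * f x)"
  have \<beta>: "\<beta> > 1 - \<epsilon> / 2" "\<beta> > 0" "\<beta> \<le> 1"
    using mass \<epsilon> L1_norm_indicator_le[OF B f(1)] f(2) unfolding \<beta>_def by auto
  define g where "g x = inverse \<beta> * (indicator B x * f x)" for x
  have fB: "integrable M (\<lambda>x. indicator B x * f x)"
    by (rule integrable_indicator_mult[OF B f(1)])
  have g: "integrable M g" "L1_norm M g = 1"
    using fB \<beta> unfolding g_def L1_norm_scale \<beta>_def[symmetric] by auto
  have S_le: "norm (S h) \<le> L1_norm M h" if "integrable M h" for h
    unfolding S_def using bump_operator_norm_le[OF T T_le B f(1) u(2,3) that] .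
  have S: "L1_operator M S"
    unfolding S_def using L1_operator_bump_operator[OF T T_le B f(1) u(2,3)] .
  have gB: "(\<lambda>x. indicator B x * g x) = g"
    by (auto simp: g_def indicator_def fun_eq_iff)
  have "(\<integral>x. g x * sgn (f x) \<partial>M) = (\<integral>x. \<bar>g x\<bar> \<partial>M)"
    using \<beta>(2) unfolding g_def
    by (intro Bochner_Integration.integral_cong) (auto simp: abs_mult sgn_real_def)
  also have "\<dots> = 1"
    using g(2) by (simp add: L1_norm_def)
  \<comment> \<open>As \<open>g\<close> lives on \<open>B\<close> and \<open>u\<close> is 1 at
    \<open>t\<^sub>0\<close>, the two terms containing \<open>T\<close> cancel there and only the
    pairing of \<open>g\<close> with \<open>sgn f\<close> remains.\<close>
  finally have "apply_bcontfun (S g) t\<^sub>0 = 1"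
    unfolding S_def bump_operator_def gB fun_cong[OF gB] by (simp add: u(1))
  then have "norm (S g) \<ge> 1"
    using norm_bounded[of "S g" t\<^sub>0] by simp
  then have Sg: "norm (S g) = 1"
    using S_le[OF g(1)] g(2) by simp
  have opS: "L1_opnorm M S = 1"
  proof (rule antisym)
    show "L1_opnorm M S \<le> 1" by (rule L1_opnorm_leI) (use S_le in auto)
    show "1 \<le> L1_opnorm M S" using L1_opnorm_bound[OF S g(1)] Sg g(2) by simp
  qed
  have dist: "norm (S h - T h) \<le> 3 * \<epsilon> / 4 * L1_norm M h" if h: "integrable M h" for h
  proof (rule norm_bound)
    fix t
    define hB where "hB = (\<lambda>x. indicator B x * h x)"
    have hB: "integrable M hB"
      unfolding hB_def by (rule integrable_indicator_mult[OF B h])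
    define c where "c = (\<integral>x. hB x * sgn (f x) \<partial>M)"
    have eq: "apply_bcontfun (S h - T h) t = apply_bcontfun u t * (c - apply_bcontfun (T hB) t)"
      by (simp add: S_def bump_operator_def c_def hB_def algebra_simps)
    show "norm (apply_bcontfun (S h - T h) t) \<le> 3 * \<epsilon> / 4 * L1_norm M h"
    proof (cases "t \<in> U")
      case False
      then show ?thesis
        using u(4) \<epsilon> L1_norm_nonneg[of M h] unfolding eq by simp
    next
      case True
      have fm: "f \<in> borel_measurable M" using f(1) by auto
      have i1: "integrable M (\<lambda>x. hB x * sgn (f x))"
        by (rule integrable_mult_sgn[OF hB fm])
      have i2: "integrable M (\<lambda>x. hB x * \<phi> x)"
      proof (rule Bochner_Integration.integrable_bound[OF hB])
        show "(\<lambda>x. hB x * \<phi> x) \<in> borel_measurable M" using hB \<phi>(1) by measurable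
        show "AE x in M. norm (hB x * \<phi> x) \<le> norm (hB x)"
          using \<phi>(2) by eventually_elim (simp add: abs_mult mult_left_le)
      qed
      have "\<bar>c - apply_bcontfun (T hB) t\<^sub>0\<bar> = \<bar>\<integral>x. hB x * sgn (f x) - hB x * \<phi> x \<partial>M\<bar>"
        unfolding c_def \<phi>(3)[OF hB] using i1 i2 by simp
      also have "\<dots> \<le> (\<integral>x. \<bar>hB x * sgn (f x) - hB x * \<phi> x\<bar> \<partial>M)"
        by (rule integral_abs_bound)
      also have "\<dots> \<le> (\<integral>x. \<epsilon> / 2 * \<bar>hB x\<bar> \<partial>M)"
      proof (rule integral_mono_AE)
        show "AE x in M. \<bar>hB x * sgn (f x) - hB x * \<phi> x\<bar> \<le> \<epsilon> / 2 * \<bar>hB x\<bar>"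
          using \<phi>(2)
        proof eventually_elim
          case (elim x)
          show ?case
          proof (cases "x \<in> B")
            case False
            then show ?thesis by (simp add: hB_def)
          next
            case True
            \<comment> \<open>The bound \<open>B\<phi>\<close> excludes \<open>f x = 0\<close>. So
              the sign is 1 or -1, and the distance equals \<open>1 - sgn (f x) * \<phi> x\<close>
              because \<open>\<phi> x\<close> has modulus at most 1.\<close>
            have "\<bar>sgn (f x) - \<phi> x\<bar> \<le> \<epsilon> / 2"
              using B\<phi>[OF True] elim \<epsilon> by (auto simp: sgn_real_def abs_le_iff split: if_splits)
            then have "\<bar>hB x\<bar> * \<bar>sgn (f x) - \<phi> x\<bar> \<le> \<bar>hB x\<bar> * (\<epsilon> / 2)"
              by (intro mult_left_mono) auto
            then show ?thesis
              by (simp add: abs_mult[symmetric] right_diff_distrib mult.commute)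
          qed
        qed
      qed (use hB i1 i2 in auto)
      also have "\<dots> = \<epsilon> / 2 * L1_norm M hB"
        by (simp add: L1_norm_def)
      also have "\<dots> \<le> \<epsilon> / 2 * L1_norm M h"
        using L1_norm_indicator_le[OF B h] \<epsilon> unfolding hB_def by (intro mult_left_mono) auto
      finally have "\<bar>c - apply_bcontfun (T hB) t\<^sub>0\<bar> \<le> \<epsilon> / 2 * L1_norm M h" .
      moreover have "\<bar>apply_bcontfun (T hB) t - apply_bcontfun (T hB) t\<^sub>0\<bar> \<le> \<epsilon> / 4 * L1_norm M h"
        unfolding hB_def by (rule osc[OF h True])
      ultimately have "\<bar>c - apply_bcontfun (T hB) t\<bar> \<le> 3 * \<epsilon> / 4 * L1_norm M h"
        by linarith
      moreover have "norm (apply_bcontfun (S h - T h) t) \<le> \<bar>c - apply_bcontfun (T hB) t\<bar>"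
        unfolding eq using u(2,3)[of t] by (simp add: abs_mult mult_left_le_one_le)
      ultimately show ?thesis by linarith
    qed
  qed
  \<comment> \<open>The operator norm is a supremum, so strictness has to come from the slack
    between \<open>3 * \<epsilon> / 4\<close> and \<open>\<epsilon>\<close>.\<close>
  have "L1_opnorm M (\<lambda>h. S h - T h) \<le> 3 * \<epsilon> / 4"
    by (rule L1_opnorm_leI) (use dist \<epsilon> in auto)
  then have "L1_opnorm M (\<lambda>h. S h - T h) < \<epsilon>"
    using \<epsilon> by simp
  moreover have "L1_norm M (\<lambda>x. f x - g x) < \<epsilon>"
  proof -
    have "integrable M (\<lambda>x. f x - g x)" using f(1) g(1) by simp
    moreover have "(\<lambda>x. indicator B x * (f x - g x)) = (\<lambda>x. (1 - inverse \<beta>) * (indicator B x * f x))"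
      by (rule ext) (simp add: g_def indicator_def algebra_simps)
    moreover have "(\<lambda>x. indicator (space M - B) x * (f x - g x)) = (\<lambda>x. indicator (space M - B) x * f x)"
      by (rule ext) (simp add: g_def indicator_def)
    ultimately have "L1_norm M (\<lambda>x. f x - g x) =
        L1_norm M (\<lambda>x. (1 - inverse \<beta>) * (indicator B x * f x)) + L1_norm M (\<lambda>x. indicator (space M - B) x * f x)"
      using L1_norm_indicator_split[OF B] by metis
    \<comment> \<open>Rescaling on \<open>B\<close> and dropping the rest of \<open>f\<close> each
      cost \<open>1 - \<beta>\<close>; this is why the lost mass must stay below
      \<open>\<epsilon> / 2\<close>.\<close>
    also have "\<dots> = \<bar>1 - inverse \<beta>\<bar> * \<beta> + (1 - \<beta>)"
      using L1_norm_indicator_split[OF B f(1)] f(2) unfolding L1_norm_scale \<beta>_def by simp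
    also have "\<bar>1 - inverse \<beta>\<bar> * \<beta> = 1 - \<beta>"
      using \<beta> by (simp add: abs_if field_simps)
    finally show ?thesis using \<beta>(1) by simp
  qed
  ultimately show ?thesis
    using that[of u g] u(2,3) opS g Sg unfolding S_def by blast
qed

text \<open>Egorov's argument, with smallness of the exceptional set measured by the mass of
  \<open>f\<close>. On \<open>B\<close> the representing function is within \<open>d / 4\<close> of
  the finitely valued \<open>s n\<close>, and \<open>U\<close> makes these finitely many values vary
  by less than \<open>d / 2\<close>. Two approximation errors bring the total to
  \<open>d\<close>.\<close>

lemma bochner_representable_small_oscillation:
  fixes T :: "('a \<Rightarrow> real) \<Rightarrow> ('k::topological_space \<Rightarrow>\<^sub>C real)"
  assumes T: "bochner_representable M T" and f: "integrable M f" and A: "A \<in> sets M"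
    and d: "d > 0" and e: "e > 0"
  obtains B U where "B \<in> sets M" "B \<subseteq> A" "open U" "t\<^sub>0 \<in> U"
    "L1_norm M (\<lambda>x. indicator B x * f x) > L1_norm M (\<lambda>x. indicator A x * f x) - e"
    "\<And>h t. integrable M h \<Longrightarrow> t \<in> U \<Longrightarrow>
      \<bar>apply_bcontfun (T (\<lambda>x. indicator B x * h x)) t - apply_bcontfun (T (\<lambda>x. indicator B x * h x)) t\<^sub>0\<bar>
        \<le> d * L1_norm M h"
proof -
  obtain G where G: "strongly_measurable M G"
    "\<And>h. integrable M h \<Longrightarrow> has_strong_bochner_integral M (\<lambda>x. h x *\<^sub>R G x) (T h)"
    using T unfolding bochner_representable_def by blast
  obtain s where s: "\<And>i. simple_function M (s i)" "AE x in M. (\<lambda>i. s i x) \<longlonglongrightarrow> G x"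
    using G(1) unfolding strongly_measurable_def by blast
  \<comment> \<open>A uniform Cauchy condition on the simple functions is used instead of distance
    to \<open>G\<close>: its measurability is immediate, and it yields the distance to
    \<open>G\<close> in the limit.\<close>
  define C where "C n = {x \<in> space M. \<forall>j k. n \<le> j \<longrightarrow> n \<le> k \<longrightarrow> norm (s j x - s k x) \<le> d / 4}" for n
  have [measurable]: "(\<lambda>x. norm (s j x - s k x)) \<in> borel_measurable M" for j k
    using simple_function_compose2[OF s(1) s(1), of "\<lambda>y z. norm (y - z)" j k]
    by (rule borel_measurable_simple_function)
  have C: "C n \<in> sets M" for n
    unfolding C_def by measurable
  have fA: "f \<in> borel_measurable M" using f by auto
  \<comment> \<open>Almost every point lies in all \<open>C n\<close> from some index on, so
    dominated convergence shows that the lost mass of \<open>f\<close> tends to 0.\<close>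
  have "(\<lambda>n. \<integral>x. \<bar>indicator (A \<inter> C n) x * f x\<bar> \<partial>M) \<longlonglongrightarrow> (\<integral>x. \<bar>indicator A x * f x\<bar> \<partial>M)"
  proof (rule integral_dominated_convergence[where w = "\<lambda>x. \<bar>f x\<bar>"])
    show "AE x in M. (\<lambda>n. \<bar>indicator (A \<inter> C n) x * f x\<bar>) \<longlonglongrightarrow> \<bar>indicator A x * f x\<bar>"
      using s(2) AE_space
    proof eventually_elim
      case (elim x)
      have "Cauchy (\<lambda>i. s i x)" using elim(1) by (rule LIMSEQ_imp_Cauchy)
      then obtain N where N: "\<forall>j\<ge>N. \<forall>k\<ge>N. norm (s j x - s k x) < d / 4"
        using d unfolding Cauchy_iff by (metis zero_less_divide_iff zero_less_numeral)
      have "\<bar>indicator (A \<inter> C n) x * f x\<bar> = \<bar>indicator A x * f x\<bar>" if "n \<ge> N" for n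
        using N that elim(2) by (auto simp: C_def indicator_def intro!: less_imp_le)
      then show ?case
        by (intro tendsto_eventually) (auto simp: eventually_sequentially)
    qed
  qed (use A C fA f in \<open>auto simp: indicator_def\<close>)
  from order_tendstoD(1)[OF this, of "L1_norm M (\<lambda>x. indicator A x * f x) - e"]
  obtain n where n: "(\<integral>x. \<bar>indicator (A \<inter> C n) x * f x\<bar> \<partial>M) > L1_norm M (\<lambda>x. indicator A x * f x) - e"
    using e by (auto simp: L1_norm_def eventually_sequentially)
  define B where "B = A \<inter> C n"
  have B: "B \<in> sets M" unfolding B_def using A C by auto
  have fin: "finite (s n ` space M)"
    using s(1)[of n] by (simp add: simple_function_def)
  define U where "U = (\<Inter>y\<in>s n ` space M. {t. \<bar>apply_bcontfun y t - apply_bcontfun y t\<^sub>0\<bar> < d / 2})"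
  show ?thesis
  proof
    show "B \<in> sets M" "B \<subseteq> A" using B by (auto simp: B_def)
    show "open U"
      unfolding U_def using fin
      by (intro open_INT ballI open_Collect_less continuous_intros) auto
    show "t\<^sub>0 \<in> U" using d by (simp add: U_def)
    show "L1_norm M (\<lambda>x. indicator B x * f x) > L1_norm M (\<lambda>x. indicator A x * f x) - e"
      using n by (simp add: B_def L1_norm_def)
    fix h :: "'a \<Rightarrow> real" and t assume h: "integrable M h" and t: "t \<in> U"
    define L where "L y = apply_bcontfun y t - apply_bcontfun y t\<^sub>0" for y :: "'k \<Rightarrow>\<^sub>C real"
    have L: "bounded_linear L"
      unfolding L_def by (intro bounded_linear_sub bounded_linear_apply_bcontfun)
    interpret L: bounded_linear L by (rule L)
    have hB: "integrable M (\<lambda>x. indicator B x * h x)"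
      by (rule integrable_indicator_mult[OF B h])
    have "\<bar>L (T (\<lambda>x. indicator B x * h x))\<bar> \<le> (\<integral>x. d * \<bar>indicator B x * h x\<bar> \<partial>M)"
    proof (rule has_strong_bochner_integral_functional_bound[OF G(2)[OF hB] L])
      show "integrable M (\<lambda>x. d * \<bar>indicator B x * h x\<bar>)" using hB by simp
      show "AE x in M. \<bar>L ((indicator B x * h x) *\<^sub>R G x)\<bar> \<le> d * \<bar>indicator B x * h x\<bar>"
        using s(2)
      proof eventually_elim
        case (elim x)
        show ?case
        proof (cases "x \<in> B")
          case False
          then show ?thesis by (simp add: L.zero)
        next
          case True
          have "(\<lambda>j. norm (s j x - s n x)) \<longlonglongrightarrow> norm (G x - s n x)"
            by (intro tendsto_norm tendsto_diff elim tendsto_const)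
          moreover have "norm (s j x - s n x) \<le> d / 4" if "j \<ge> n" for j
            using True that by (auto simp: B_def C_def)
          ultimately have "norm (G x - s n x) \<le> d / 4"
            by (intro LIMSEQ_le_const2[of _ _ "d / 4"]) auto
          then have "\<bar>apply_bcontfun (G x) r - apply_bcontfun (s n x) r\<bar> \<le> d / 4" for r
            using norm_bounded[of "G x - s n x" r] by simp
          from this[of t] this[of t\<^sub>0] have "\<bar>L (G x)\<bar> \<le> \<bar>L (s n x)\<bar> + d / 2"
            unfolding L_def by linarith
          also have "\<dots> \<le> d"
            using t True by (auto simp: U_def L_def B_def C_def)
          finally have "\<bar>indicator B x * h x\<bar> * \<bar>L (G x)\<bar> \<le> \<bar>indicator B x * h x\<bar> * d"
            by (intro mult_left_mono) auto
          then show ?thesis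
            by (simp add: L.scaleR abs_mult mult.commute)
        qed
      qed
    qed
    also have "\<dots> = d * L1_norm M (\<lambda>x. indicator B x * h x)"
      by (simp add: L1_norm_def)
    also have "\<dots> \<le> d * L1_norm M h"
      using L1_norm_indicator_le[OF B h] d by (intro mult_left_mono) auto
    finally show "\<bar>apply_bcontfun (T (\<lambda>x. indicator B x * h x)) t - apply_bcontfun (T (\<lambda>x. indicator B x * h x)) t\<^sub>0\<bar>
        \<le> d * L1_norm M h"
      by (simp add: L_def)
  qed
qed

text \<open>The image of the unit ball consists of functions of norm at most one and is closed under
  half differences, so the oscillation result for weakly compact sets applies; homogeneity removes
  the restriction to the ball.\<close>

lemma weakly_compact_operator_small_oscillation:
  fixes T :: "('a \<Rightarrow> real) \<Rightarrow> ('k::t2_space \<Rightarrow>\<^sub>C real)"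
  assumes K: "compact (UNIV :: 'k set)" and wc: "weakly_compact_operator M T"
    and T: "L1_operator M T" and T_le: "\<And>h. integrable M h \<Longrightarrow> norm (T h) \<le> L1_norm M h"
    and V: "open V" "V \<noteq> {}" and d: "d > 0"
  obtains U t\<^sub>0 where "open U" "t\<^sub>0 \<in> U" "U \<subseteq> V"
    "\<And>h t. integrable M h \<Longrightarrow> t \<in> U \<Longrightarrow> \<bar>apply_bcontfun (T h) t - apply_bcontfun (T h) t\<^sub>0\<bar> \<le> d * L1_norm M h"
proof -
  have 1: "norm y \<le> 1" if "y \<in> T ` L1_unit_ball M" for y
  proof -
    obtain h where "y = T h" "integrable M h" "L1_norm M h \<le> 1"
      using \<open>y \<in> T ` L1_unit_ball M\<close> by (auto simp: L1_unit_ball_def)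
    then show ?thesis using T_le[of h] by simp
  qed
  have 2: "(1/2) *\<^sub>R (y - z) \<in> T ` L1_unit_ball M"
    if yz: "y \<in> T ` L1_unit_ball M" "z \<in> T ` L1_unit_ball M" for y z
  proof -
    obtain h k where h: "y = T h" "integrable M h" "L1_norm M h \<le> 1"
      and k: "z = T k" "integrable M k" "L1_norm M k \<le> 1"
      using yz by (auto simp: L1_unit_ball_def)
    have i: "integrable M (\<lambda>x. h x - k x)" using h k by simp
    have "L1_norm M (\<lambda>x. h x - k x) \<le> (\<integral>x. \<bar>h x\<bar> + \<bar>k x\<bar> \<partial>M)"
      unfolding L1_norm_def using h k by (intro integral_mono) auto
    also have "\<dots> = L1_norm M h + L1_norm M k"
      using h k by (simp add: L1_norm_def)
    finally have "L1_norm M (\<lambda>x. (1/2) * (h x - k x)) \<le> 1"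
      using h(3) k(3) unfolding L1_norm_scale by simp
    then have "(\<lambda>x. (1/2) * (h x - k x)) \<in> L1_unit_ball M"
      using i by (simp add: L1_unit_ball_def)
    moreover have "T (\<lambda>x. (1/2) * (h x - k x)) = (1/2) *\<^sub>R (y - z)"
      unfolding L1_operator_scale[OF T i] L1_operator_diff[OF T h(2) k(2)] h(1) k(1) ..
    ultimately show ?thesis by (intro rev_image_eqI) auto
  qed
  obtain U t\<^sub>0 where U: "open U" "t\<^sub>0 \<in> U" "U \<subseteq> V"
    "\<And>y t. y \<in> T ` L1_unit_ball M \<Longrightarrow> t \<in> U \<Longrightarrow> \<bar>apply_bcontfun y t - apply_bcontfun y t\<^sub>0\<bar> \<le> d"
    by (rule weakly_compact_small_oscillation[OF K wc[unfolded weakly_compact_operator_def] 1 2 V d]) (assumption | (rule that; simp))+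
  show ?thesis
  proof (rule that[OF U(1-3)])
    fix h :: "'a \<Rightarrow> real" and t assume h: "integrable M h" and t: "t \<in> U"
    obtain k where k: "k \<in> L1_unit_ball M" "T h = L1_norm M h *\<^sub>R T k"
      using L1_operator_normalize[OF T h] .
    have "\<bar>apply_bcontfun (T h) t - apply_bcontfun (T h) t\<^sub>0\<bar>
        = L1_norm M h * \<bar>apply_bcontfun (T k) t - apply_bcontfun (T k) t\<^sub>0\<bar>"
      unfolding k(2) using L1_norm_nonneg[of M h]
      by (simp add: right_diff_distrib[symmetric] abs_mult)
    also have "\<dots> \<le> L1_norm M h * d"
      using U(4)[of "T k" t] k(1) t L1_norm_nonneg[of M h] by (intro mult_left_mono) auto
    finally show "\<bar>apply_bcontfun (T h) t - apply_bcontfun (T h) t\<^sub>0\<bar> \<le> d * L1_norm M h"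
      by (simp add: mult.commute)
  qed
qed

text \<open>A Chebyshev estimate, and the source of the constant
  \<open>\<epsilon>\<^sup>2 / 6\<close>. The defect \<open>1 - T f\<close> at
  \<open>t\<^sub>0\<close> is the integral of \<open>\<bar>f\<bar> * (1 - sgn f * \<phi>)\<close>,
  hence at least \<open>\<epsilon> / 2\<close> times the mass of \<open>f\<close> off the set. As
  the defect is below \<open>\<epsilon> / 2 * (\<epsilon> / 3)\<close>, that mass is below
  \<open>\<epsilon> / 3\<close>.\<close>

lemma evaluation_density:
  fixes T :: "('a \<Rightarrow> real) \<Rightarrow> ('k::topological_space \<Rightarrow>\<^sub>C real)"
  assumes fm: "finite_measure M" and \<epsilon>: "0 < \<epsilon>" "\<epsilon> < 1"
    and T: "L1_operator M T" and T_le: "\<And>h. integrable M h \<Longrightarrow> norm (T h) \<le> L1_norm M h"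
    and f: "integrable M f" "L1_norm M f = 1"
    and t0: "apply_bcontfun (T f) t\<^sub>0 > 1 - \<epsilon>\<^sup>2 / 6"
  obtains \<phi> where "\<phi> \<in> borel_measurable M" "AE x in M. \<bar>\<phi> x\<bar> \<le> 1"
      "\<And>h. integrable M h \<Longrightarrow> apply_bcontfun (T h) t\<^sub>0 = (\<integral>x. h x * \<phi> x \<partial>M)"
      "L1_norm M (\<lambda>x. indicator {x \<in> space M. sgn (f x) * \<phi> x > 1 - \<epsilon> / 2} x * f x) > 1 - \<epsilon> / 3"
proof -
  have "L1_operator M (\<lambda>h. apply_bcontfun (T h) t\<^sub>0)"
    by (rule L1_operator_bounded_linear[OF bounded_linear_apply_bcontfun T])
  moreover have "\<bar>apply_bcontfun (T h) t\<^sub>0\<bar> \<le> L1_norm M h" if "integrable M h" for h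
    using norm_bounded[of "T h" t\<^sub>0] T_le[OF that] by simp
  ultimately obtain \<phi> where \<phi>: "\<phi> \<in> borel_measurable M" "AE x in M. \<bar>\<phi> x\<bar> \<le> 1"
    "\<And>h. integrable M h \<Longrightarrow> apply_bcontfun (T h) t\<^sub>0 = (\<integral>x. h x * \<phi> x \<partial>M)"
    using L1_dual_density[OF fm] by blast
  define A where "A = {x \<in> space M. sgn (f x) * \<phi> x > 1 - \<epsilon> / 2}"
  have [measurable]: "f \<in> borel_measurable M" "(\<lambda>x. sgn (f x)) \<in> borel_measurable M" "\<phi> \<in> borel_measurable M"
    using f(1) \<phi>(1) borel_measurable_sgn by auto
  have A: "A \<in> sets M" unfolding A_def by measurable
  have i\<phi>: "integrable M (\<lambda>x. f x * \<phi> x)"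
  proof (rule Bochner_Integration.integrable_bound[OF f(1)])
    show "AE x in M. norm (f x * \<phi> x) \<le> norm (f x)"
      using \<phi>(2) by eventually_elim (simp add: abs_mult mult_left_le)
  qed simp
  have "\<epsilon> / 2 * L1_norm M (\<lambda>x. indicator (space M - A) x * f x) = (\<integral>x. \<epsilon> / 2 * \<bar>indicator (space M - A) x * f x\<bar> \<partial>M)"
    by (simp add: L1_norm_def)
  also have "\<dots> \<le> (\<integral>x. \<bar>f x\<bar> - f x * \<phi> x \<partial>M)"
  proof (rule integral_mono_AE)
    have "integrable M (\<lambda>x. indicator (space M - A) x * f x)"
      using A f(1) by (intro integrable_indicator_mult) auto
    then show "integrable M (\<lambda>x. \<epsilon> / 2 * \<bar>indicator (space M - A) x * f x\<bar>)"
      by simp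
    show "AE x in M. \<epsilon> / 2 * \<bar>indicator (space M - A) x * f x\<bar> \<le> \<bar>f x\<bar> - f x * \<phi> x"
      using \<phi>(2)
    proof eventually_elim
      case (elim x)
      have e: "\<bar>f x\<bar> - f x * \<phi> x = \<bar>f x\<bar> * (1 - sgn (f x) * \<phi> x)"
        by (auto simp: sgn_real_def algebra_simps)
      show ?case
      proof (cases "x \<in> space M - A")
        case True
        then have "\<epsilon> / 2 \<le> 1 - sgn (f x) * \<phi> x" by (auto simp: A_def)
        then have "\<epsilon> / 2 * \<bar>f x\<bar> \<le> (1 - sgn (f x) * \<phi> x) * \<bar>f x\<bar>"
          by (rule mult_right_mono) simp
        then show ?thesis unfolding e using True
          by (simp add: mult.commute)
      next
        case False
        have "sgn (f x) * \<phi> x \<le> 1"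
          using elim by (auto simp: sgn_real_def abs_le_iff)
        then show ?thesis unfolding e using False by simp
      qed
    qed
  qed (use f(1) i\<phi> in auto)
  also have "\<dots> = 1 - apply_bcontfun (T f) t\<^sub>0"
    using f i\<phi> by (simp add: L1_norm_def \<phi>(3)[OF f(1)])
  also have "\<dots> < \<epsilon> / 2 * (\<epsilon> / 3)"
    using t0 by (simp add: power2_eq_square)
  finally have "L1_norm M (\<lambda>x. indicator (space M - A) x * f x) < \<epsilon> / 3"
    using \<epsilon> by simp
  then have "L1_norm M (\<lambda>x. indicator A x * f x) > 1 - \<epsilon> / 3"
    using L1_norm_indicator_split[OF A f(1)] f(2) by simp
  then show ?thesis
    using that \<phi> unfolding A_def by blast
qed

text \<open>The predicate \<open>P\<close> lets both operator classes share the construction: each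
  case only has to supply \<open>t\<^sub>0\<close>, \<open>U\<close>, \<open>B\<close> and
  \<open>\<phi>\<close> to \<open>concl\<close>.\<close>

lemma norm_attaining_approximation_positive:
  fixes T :: "('a \<Rightarrow> real) \<Rightarrow> ('k::t2_space \<Rightarrow>\<^sub>C real)"
  assumes fm: "finite_measure M" and K: "compact (UNIV :: 'k set)" and \<epsilon>: "0 < \<epsilon>" "\<epsilon> < 1"
    and T: "L1_operator M T" "L1_opnorm M T = 1"
    and f: "integrable M f" "L1_norm M f = 1"
    and t1: "apply_bcontfun (T f) t\<^sub>1 > 1 - \<epsilon>\<^sup>2 / 6"
    and P: "P = bochner_representable M \<or> P = weakly_compact_operator M" "P T"
  obtains S g where "L1_operator M S" "P S" "L1_opnorm M S = 1"
    "integrable M g" "L1_norm M g = 1" "norm (S g) = 1"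
    "L1_opnorm M (\<lambda>h. S h - T h) < \<epsilon>" "L1_norm M (\<lambda>x. f x - g x) < \<epsilon>"
proof -
  note found = that
  have T_le: "norm (T h) \<le> L1_norm M h" if "integrable M h" for h
    using L1_opnorm_bound[OF T(1) that] T(2) by simp
  have concl: thesis
    if U: "open U" "t\<^sub>0 \<in> U" and B: "B \<in> sets M"
      and \<phi>: "\<phi> \<in> borel_measurable M" "AE x in M. \<bar>\<phi> x\<bar> \<le> 1"
        "\<And>h. integrable M h \<Longrightarrow> apply_bcontfun (T h) t\<^sub>0 = (\<integral>x. h x * \<phi> x \<partial>M)"
      and B\<phi>: "\<And>x. x \<in> B \<Longrightarrow> sgn (f x) * \<phi> x > 1 - \<epsilon> / 2"
      and mass: "L1_norm M (\<lambda>x. indicator B x * f x) > 1 - \<epsilon> / 2"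
      and osc: "\<And>h t. integrable M h \<Longrightarrow> t \<in> U \<Longrightarrow>
        \<bar>apply_bcontfun (T (\<lambda>x. indicator B x * h x)) t - apply_bcontfun (T (\<lambda>x. indicator B x * h x)) t\<^sub>0\<bar>
          \<le> \<epsilon> / 4 * L1_norm M h"
    for U t\<^sub>0 B \<phi>
  proof -
    obtain u g where u: "\<And>t. 0 \<le> apply_bcontfun u t" "\<And>t. apply_bcontfun u t \<le> 1"
      and g: "L1_opnorm M (bump_operator M T u B f) = 1"
      "integrable M g" "L1_norm M g = 1" "norm (bump_operator M T u B f g) = 1"
      "L1_opnorm M (\<lambda>h. bump_operator M T u B f h - T h) < \<epsilon>" "L1_norm M (\<lambda>x. f x - g x) < \<epsilon>"
      by (rule bump_operator_attains_norm[OF K \<epsilon> T(1) T_le f U B \<phi> B\<phi> mass osc])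
        (assumption | (rule that; simp))+
    have "L1_operator M (bump_operator M T u B f)"
      using L1_operator_bump_operator[OF T(1) T_le B f(1) u] .
    moreover have "P (bump_operator M T u B f)"
      using P bochner_representable_bump_operator[OF T(1) T_le B f(1) u]
        weakly_compact_bump_operator[OF T(1) T_le B f(1) u] by fastforce
    ultimately show thesis
      using g by (rule found)
  qed
  show thesis
    using P(1)
  proof
    assume "P = bochner_representable M"
    then have br: "bochner_representable M T" using P(2) by simp
    obtain \<phi> where \<phi>: "\<phi> \<in> borel_measurable M" "AE x in M. \<bar>\<phi> x\<bar> \<le> 1"
      "\<And>h. integrable M h \<Longrightarrow> apply_bcontfun (T h) t\<^sub>1 = (\<integral>x. h x * \<phi> x \<partial>M)"
      and mass: "L1_norm M (\<lambda>x. indicator {x \<in> space M. sgn (f x) * \<phi> x > 1 - \<epsilon> / 2} x * f x) > 1 - \<epsilon> / 3"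
      by (rule evaluation_density[OF fm \<epsilon> T(1) T_le f t1]) (assumption | (rule that; simp))+
    define A where "A = {x \<in> space M. sgn (f x) * \<phi> x > 1 - \<epsilon> / 2}"
    have [measurable]: "f \<in> borel_measurable M" "(\<lambda>x. sgn (f x)) \<in> borel_measurable M" "\<phi> \<in> borel_measurable M"
      using f(1) \<phi>(1) borel_measurable_sgn by auto
    have A: "A \<in> sets M" unfolding A_def by measurable
    \<comment> \<open>\<open>A\<close> misses less than \<open>\<epsilon> / 3\<close> of the mass of
      \<open>f\<close>; giving up less than a further \<open>\<epsilon> / 6\<close> keeps the loss
      below the permitted \<open>\<epsilon> / 2\<close>.\<close>
    have e: "\<epsilon> / 4 > 0" "\<epsilon> / 6 > 0" using \<epsilon> by auto
    obtain B U where BU: "B \<in> sets M" "B \<subseteq> A" "open U" "t\<^sub>1 \<in> U"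
      "L1_norm M (\<lambda>x. indicator B x * f x) > L1_norm M (\<lambda>x. indicator A x * f x) - \<epsilon> / 6"
      "\<And>h t. integrable M h \<Longrightarrow> t \<in> U \<Longrightarrow>
        \<bar>apply_bcontfun (T (\<lambda>x. indicator B x * h x)) t - apply_bcontfun (T (\<lambda>x. indicator B x * h x)) t\<^sub>1\<bar>
          \<le> \<epsilon> / 4 * L1_norm M h"
      by (rule bochner_representable_small_oscillation[where t\<^sub>0 = t\<^sub>1, OF br f(1) A e])
        (assumption | (rule that; simp))+
    have "L1_norm M (\<lambda>x. indicator B x * f x) > 1 - \<epsilon> / 2"
      using BU(5) mass unfolding A_def[symmetric] by linarith
    moreover have "sgn (f x) * \<phi> x > 1 - \<epsilon> / 2" if "x \<in> B" for x
      using that BU(2) by (auto simp: A_def)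
    ultimately show thesis
      by (intro concl[OF BU(3,4,1) \<phi> _ _ BU(6)])
  next
    assume "P = weakly_compact_operator M"
    then have wc: "weakly_compact_operator M T" using P(2) by simp
    \<comment> \<open>Small oscillation is available only around some point of a given open set.
      Inside \<open>V\<close> the value of \<open>T f\<close> stays above the threshold, so the
      density can be taken at the new point \<open>t\<^sub>0\<close>.\<close>
    define V where "V = {t. apply_bcontfun (T f) t > 1 - \<epsilon>\<^sup>2 / 6}"
    have V: "open V" "V \<noteq> {}"
      unfolding V_def using t1 by (auto intro!: open_Collect_less continuous_intros)
    have e: "\<epsilon> / 4 > 0" using \<epsilon> by auto
    obtain U t\<^sub>0 where U: "open U" "t\<^sub>0 \<in> U" "U \<subseteq> V"
      "\<And>h t. integrable M h \<Longrightarrow> t \<in> U \<Longrightarrow> \<bar>apply_bcontfun (T h) t - apply_bcontfun (T h) t\<^sub>0\<bar> \<le> \<epsilon> / 4 * L1_norm M h"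
      by (rule weakly_compact_operator_small_oscillation[OF K wc T(1) T_le V e])
        (assumption | (rule that; simp))+
    have t0: "apply_bcontfun (T f) t\<^sub>0 > 1 - \<epsilon>\<^sup>2 / 6"
      using U(2,3) by (auto simp: V_def)
    obtain \<phi> where \<phi>: "\<phi> \<in> borel_measurable M" "AE x in M. \<bar>\<phi> x\<bar> \<le> 1"
      "\<And>h. integrable M h \<Longrightarrow> apply_bcontfun (T h) t\<^sub>0 = (\<integral>x. h x * \<phi> x \<partial>M)"
      and mass: "L1_norm M (\<lambda>x. indicator {x \<in> space M. sgn (f x) * \<phi> x > 1 - \<epsilon> / 2} x * f x) > 1 - \<epsilon> / 3"
      by (rule evaluation_density[OF fm \<epsilon> T(1) T_le f t0]) (assumption | (rule that; simp))+
    define A where "A = {x \<in> space M. sgn (f x) * \<phi> x > 1 - \<epsilon> / 2}"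
    have [measurable]: "f \<in> borel_measurable M" "(\<lambda>x. sgn (f x)) \<in> borel_measurable M" "\<phi> \<in> borel_measurable M"
      using f(1) \<phi>(1) borel_measurable_sgn by auto
    have A: "A \<in> sets M" unfolding A_def by measurable
    \<comment> \<open>Here \<open>B\<close> is \<open>A\<close> itself: the oscillation bound holds
      for all integrable functions, and restriction to \<open>A\<close> does not increase the
      norm.\<close>
    have oscA: "\<bar>apply_bcontfun (T (\<lambda>x. indicator A x * h x)) t - apply_bcontfun (T (\<lambda>x. indicator A x * h x)) t\<^sub>0\<bar>
          \<le> \<epsilon> / 4 * L1_norm M h" if h: "integrable M h" and t: "t \<in> U" for h t
    proof -
      have "\<epsilon> / 4 * L1_norm M (\<lambda>x. indicator A x * h x) \<le> \<epsilon> / 4 * L1_norm M h"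
        using L1_norm_indicator_le[OF A h] \<epsilon> by (intro mult_left_mono) auto
      with U(4)[OF integrable_indicator_mult[OF A h] t] show ?thesis by linarith
    qed
    have "L1_norm M (\<lambda>x. indicator A x * f x) > 1 - \<epsilon> / 2"
      using mass \<epsilon> unfolding A_def[symmetric] by linarith
    moreover have "sgn (f x) * \<phi> x > 1 - \<epsilon> / 2" if "x \<in> A" for x
      using that by (auto simp: A_def)
    ultimately show thesis
      by (intro concl[OF U(1,2) A \<phi> _ _ oscA])
  qed
qed

text \<open>If \<open>T f\<close> is close to -1 instead of 1 at the chosen point, the positive case
  is applied to \<open>-f\<close> with the same \<open>T\<close>; then \<open>S\<close> is kept and
  \<open>g\<close> changes sign.\<close>

lemma norm_attaining_approximation:
  fixes T :: "('a \<Rightarrow> real) \<Rightarrow> ('k::t2_space \<Rightarrow>\<^sub>C real)"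
  assumes fm: "finite_measure M" and K: "compact (UNIV :: 'k set)" and \<epsilon>: "0 < \<epsilon>" "\<epsilon> < 1"
    and T: "L1_operator M T" "L1_opnorm M T = 1"
    and f: "integrable M f" "L1_norm M f = 1"
    and Tf: "norm (T f) > 1 - \<epsilon>\<^sup>2 / 6"
    and P: "P = bochner_representable M \<or> P = weakly_compact_operator M" "P T"
  shows "\<exists>S g. L1_operator M S \<and> P S \<and> L1_opnorm M S = 1 \<and>
    integrable M g \<and> L1_norm M g = 1 \<and> norm (S g) = 1 \<and>
    L1_opnorm M (\<lambda>h. S h - T h) < \<epsilon> \<and> L1_norm M (\<lambda>x. f x - g x) < \<epsilon>"
proof -
  \<comment> \<open>Contraposition: a bound on all point values would bound the supremum
    norm.\<close>
  obtain t\<^sub>1 where "\<bar>apply_bcontfun (T f) t\<^sub>1\<bar> > 1 - \<epsilon>\<^sup>2 / 6"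
    using Tf norm_bound[of "T f" "1 - \<epsilon>\<^sup>2 / 6"] by (metis not_le real_norm_def)
  then consider "apply_bcontfun (T f) t\<^sub>1 > 1 - \<epsilon>\<^sup>2 / 6" | "- apply_bcontfun (T f) t\<^sub>1 > 1 - \<epsilon>\<^sup>2 / 6"
    by linarith
  then show ?thesis
  proof cases
    case 1
    show ?thesis
      by (rule norm_attaining_approximation_positive[OF fm K \<epsilon> T f 1 P]) (intro exI conjI)
  next
    case 2
    define f' where "f' x = - 1 * f x" for x
    have f': "integrable M f'" "L1_norm M f' = 1"
      using f unfolding f'_def L1_norm_scale by auto
    have "T f' = - T f"
      unfolding f'_def L1_operator_scale[OF T(1) f(1)] by simp
    then have t: "apply_bcontfun (T f') t\<^sub>1 > 1 - \<epsilon>\<^sup>2 / 6"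
      using 2 by simp
    obtain S g where S: "L1_operator M S" "P S" "L1_opnorm M S = 1"
      and g: "integrable M g" "L1_norm M g = 1" "norm (S g) = 1"
      and ST: "L1_opnorm M (\<lambda>h. S h - T h) < \<epsilon>" and fg: "L1_norm M (\<lambda>x. f' x - g x) < \<epsilon>"
      using norm_attaining_approximation_positive[OF fm K \<epsilon> T f' t P] .
    have "(\<lambda>x. f x - - 1 * g x) = (\<lambda>x. - 1 * (f' x - g x))"
      by (auto simp: f'_def)
    then have "L1_norm M (\<lambda>x. f x - - 1 * g x) < \<epsilon>"
      using fg by (simp only: L1_norm_scale)
    moreover have "norm (S (\<lambda>x. - 1 * g x)) = 1"
      unfolding L1_operator_scale[OF S(1) g(1)] using g(3) by simp
    moreover have "L1_norm M (\<lambda>x. - 1 * g x) = 1"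
      unfolding L1_norm_scale using g(2) by simp
    moreover have "integrable M (\<lambda>x. - 1 * g x)"
      using g(1) by simp
    ultimately show ?thesis
      using S ST by (intro exI[of _ S] exI[of _ "\<lambda>x. - 1 * g x"]) blast
  qed
qed

theorem corollary5p3:
  fixes \<mu> :: "'a measure"
    and T :: "('a \<Rightarrow> real) \<Rightarrow> ('k::t2_space \<Rightarrow>\<^sub>C real)"
    and f :: "'a \<Rightarrow> real"
    and \<epsilon> :: real
  assumes "finite_measure \<mu>"
    and "compact (UNIV :: 'k set)"
    and "0 < \<epsilon>" and "\<epsilon> < 1"
    and "L1_operator \<mu> T" and "L1_opnorm \<mu> T = 1"
    and "integrable \<mu> f" and "L1_norm \<mu> f = 1"
    and "norm (T f) > 1 - \<epsilon>\<^sup>2 / 6"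
  shows
    "(bochner_representable \<mu> T \<longrightarrow>
       (\<exists>(S :: ('a \<Rightarrow> real) \<Rightarrow> ('k \<Rightarrow>\<^sub>C real)) g.
          L1_operator \<mu> S \<and> bochner_representable \<mu> S \<and> L1_opnorm \<mu> S = 1 \<and>
          integrable \<mu> g \<and> L1_norm \<mu> g = 1 \<and> norm (S g) = 1 \<and>
          L1_opnorm \<mu> (\<lambda>h. S h - T h) < \<epsilon> \<and> L1_norm \<mu> (\<lambda>x. f x - g x) < \<epsilon>)) \<and>
     (weakly_compact_operator \<mu> T \<longrightarrow>
       (\<exists>(S :: ('a \<Rightarrow> real) \<Rightarrow> ('k \<Rightarrow>\<^sub>C real)) g.
          L1_operator \<mu> S \<and> weakly_compact_operator \<mu> S \<and> L1_opnorm \<mu> S = 1 \<and>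
          integrable \<mu> g \<and> L1_norm \<mu> g = 1 \<and> norm (S g) = 1 \<and>
          L1_opnorm \<mu> (\<lambda>h. S h - T h) < \<epsilon> \<and> L1_norm \<mu> (\<lambda>x. f x - g x) < \<epsilon>))"
  using norm_attaining_approximation[OF assms] by blast

end
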